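(* Let $a<b$ be real numbers, $n\ge 1$ an integer, $0<d<\pi$, $0<\alpha\le 1$, and $\mathbf{r}\in\mathbb{C}^n$. Let $K=[k_{ij}]$ be an $n\times n$ matrix of functions and $\mathbf{g}=[g_1,\ldots,g_n]^{\mathrm T}$ a vector of functions, and put $Q(z)=(z-a)(b-z)$. Assume that $k_{ij}Q\in \mathbf{L}_{\alpha}(\psi^{\mathrm{SE}}(\mathscr{D}_d))$ for all $i,j=1,\ldots,n$ and $g_iQ\in \mathbf{L}_{\alpha}(\psi^{\mathrm{SE}}(\mathscr{D}_d))$ for all $i=1,\ldots,n$. Then the initial value problem $$\mathbf{y}'(t)=K(t)\mathbf{y}(t)+\mathbf{g}(t)\quad(a\le t\le b),\qquad \mathbf{y}(a)=\mathbf{r},$$ has a unique solution $\mathbf{y}=[y_1,\ldots,y_n]^{\mathrm T}$, and $y_i\in\mathbf{M}_{\alpha}(\psi^{\mathrm{SE}}(\mathscr{D}_d))$ for $i=1,\ldots,n$.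
   Context: $\mathscr{D}_d=\{\zeta\in\mathbb{C}:|\operatorname{Im}\zeta|<d\}$, $\psi^{\mathrm{SE}}(\zeta)=\frac{b-a}{2}\tanh(\zeta/2)+\frac{b+a}{2}$, and $\psi^{\mathrm{SE}}(\mathscr{D}_d)=\{\psi^{\mathrm{SE}}(\zeta):\zeta\in\mathscr{D}_d\}$, a bounded simply connected domain containing $(a,b)$ (for $0<d<\pi$). For $\mathscr{D}=\psi^{\mathrm{SE}}(\mathscr{D}_d)$: $\mathbf{H}^{\infty}(\mathscr{D})$ is the set of functions $f$ analytic on $\mathscr{D}$ with $\sup_{z\in\mathscr{D}}|f(z)|<\infty$. For $\alpha>0$, $\mathbf{L}_{\alpha}(\mathscr{D})$ is the set of $f\in\mathbf{H}^{\infty}(\mathscr{D})$ for which there is a constant $L$ with $|f(z)|\le L|Q(z)|^{\alpha}$ for all $z\in\mathscr{D}$, where $Q(z)=(z-a)(b-z)$. For $0<\alpha\le1$, $\mathbf{M}_{\alpha}(\mathscr{D})$ is the set of $f\in\mathbf{H}^{\infty}(\mathscr{D})$ for which there is a constant $M$ with $|f(z)-f(a)|\le M|z-a|^{\alpha}$ and $|f(b)-f(z)|\le M|b-z|^{\alpha}$ for all $z\in\mathscr{D}$ (here $f(a),f(b)$ are the boundary values of $f$ at $a$ and $b$). The functions $k_{ij},g_i$ may be singular (but integrable) at $a$ and $b$; the initial value problem is understood in its equivalent integrated form $\mathbf{y}(t)=\mathbf{r}+\int_a^t\{\mathbf{g}(s)+K(s)\mathbf{y}(s)\}\,ds$, $a\le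 t\le b$, for $\mathbf{y}$ continuous on $[a,b]$. A function on $[a,b]$ is said to belong to $\mathbf{M}_\alpha(\mathscr{D})$ if it extends analytically to such a function. *)

theory Defs
  imports "HOL-Complex_Analysis.Complex_Analysis"
begin

definition strip :: "real \<Rightarrow> complex set" where
  "strip d = {\<zeta>. \<bar>Im \<zeta>\<bar> < d}"

definition psi_SE :: "real \<Rightarrow> real \<Rightarrow> complex \<Rightarrow> complex" where
  "psi_SE a b \<zeta> = of_real ((b - a) / 2) * tanh (\<zeta> / 2) + of_real ((b + a) / 2)"

definition SE_domain :: "real \<Rightarrow> real \<Rightarrow> real \<Rightarrow> complex set" where
  "SE_domain a b d = psi_SE a b ` strip d"

definition Q_fun :: "real \<Rightarrow> real \<Rightarrow> complex \<Rightarrow> complex" where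
  "Q_fun a b z = (z - of_real a) * (of_real b - z)"

definition H_inf :: "complex set \<Rightarrow> (complex \<Rightarrow> complex) set" where
  "H_inf D = {f. f analytic_on D \<and> bounded (f ` D)}"

definition L_space :: "real \<Rightarrow> real \<Rightarrow> real \<Rightarrow> complex set \<Rightarrow> (complex \<Rightarrow> complex) set" where
  "L_space a b \<alpha> D =
     {f \<in> H_inf D. \<exists>L. \<forall>z\<in>D. norm (f z) \<le> L * norm (Q_fun a b z) powr \<alpha>}"

text \<open>The points \<open>a\<close> and \<open>b\<close> lie on the boundary of the domains of interest, not inside them.
  Membership requires the values \<open>f a\<close> and \<open>f b\<close> of the total function \<open>f\<close> to be the boundary
  values, that is, the limits from within \<open>D\<close>.\<close>

definition M_space :: "real \<Rightarrow> real \<Rightarrow> real \<Rightarrow> complex set \<Rightarrow> (complex \<Rightarrow> complex) set" where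
  "M_space a b \<alpha> D =
     {f \<in> H_inf D.
        (f \<longlongrightarrow> f (of_real a)) (at (of_real a) within D) \<and>
        (f \<longlongrightarrow> f (of_real b)) (at (of_real b) within D) \<and>
        (\<exists>M. \<forall>z\<in>D.
           norm (f z - f (of_real a)) \<le> M * norm (z - of_real a) powr \<alpha> \<and>
           norm (f (of_real b) - f z) \<le> M * norm (of_real b - z) powr \<alpha>)}"

definition extends_to_M_space ::
    "real \<Rightarrow> real \<Rightarrow> real \<Rightarrow> complex set \<Rightarrow> (real \<Rightarrow> complex) \<Rightarrow> bool" where
  "extends_to_M_space a b \<alpha> D y \<longleftrightarrow>
     (\<exists>f \<in> M_space a b \<alpha> D. \<forall>t\<in>{a..b}. f (of_real t) = y t)"

text \<open>The initial value problem \<open>y' = K y + g\<close>, \<open>y a = r\<close> in integrated form.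
  The coefficients may be singular at \<open>a\<close> and \<open>b\<close>; the values of the total functions \<open>K\<close> and
  \<open>g\<close> at these two points are arbitrary and do not affect the integral.\<close>

definition solves_ivp ::
    "real \<Rightarrow> real \<Rightarrow> (complex \<Rightarrow> complex ^ 'n ^ 'n) \<Rightarrow> (complex \<Rightarrow> complex ^ 'n) \<Rightarrow>
     complex ^ 'n \<Rightarrow> (real \<Rightarrow> complex ^ 'n::finite) \<Rightarrow> bool" where
  "solves_ivp a b K g r y \<longleftrightarrow>
     continuous_on {a..b} y \<and>
     (\<lambda>s. g (of_real s) + K (of_real s) *v y s) absolutely_integrable_on {a..b} \<and>
     (\<forall>t\<in>{a..b}. y t = r + integral {a..t} (\<lambda>s. g (of_real s) + K (of_real s) *v y s))"

end

theory Submission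
  imports Defs "HOL-Real_Asymp.Real_Asymp"
begin

text \<open>
  Since \<open>psi_SE' = Q (psi_SE) / (b - a)\<close>, the substitution \<open>z = psi_SE \<zeta>\<close> turns the system into
  \<open>u' = A u + h\<close> on the strip, with \<open>A = (K Q)(psi_SE) / (b - a)\<close> and \<open>h = (g Q)(psi_SE) / (b - a)\<close>
  holomorphic, and the initial point \<open>a\<close> into \<open>- \<infinity>\<close>. The growth condition makes \<open>A\<close> and \<open>h\<close> decay
  like \<open>exp (- \<alpha> \<bar>Re \<zeta>\<bar>)\<close>, so that they are dominated by \<open>\<sigma>' (Re \<zeta>)\<close> for a multiple \<open>\<sigma>\<close> of the
  logistic function \<open>1 / (1 + exp (- \<alpha> x))\<close>. Holomorphic primitives normalised at \<open>- \<infinity>\<close> take the place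
  of the improper integrals in the Picard iteration; its \<open>k\<close>-th term is bounded by a constant times
  \<open>(n \<sigma>)^(k+1) / (k+1)!\<close>. The solution satisfies \<open>\<bar>u - r\<bar> \<le> C \<sigma>\<close> and \<open>\<bar>u(\<infinity>) - u\<bar> \<le> C (\<sigma>(\<infinity>) - \<sigma>)\<close>,
  which are the two Hoelder conditions in the variable \<open>z\<close>. The same iteration on the real line shows
  that the difference of two solutions vanishes.
\<close>

subsection \<open>Limits and primitives on strips\<close>

lemma convex_strip: "convex (strip d)"
proof -
  have "strip d = {\<zeta>. Im \<zeta> < d} \<inter> {\<zeta>. Im \<zeta> > - d}"
    by (auto simp: strip_def)
  then show ?thesis
    by (auto intro!: convex_Int convex_halfspace_Im_lt convex_halfspace_Im_gt)
qed

lemma open_strip: "open (strip d)"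
  unfolding strip_def by (intro open_Collect_less continuous_intros)

lemma uminus_strip_iff: "- \<zeta> \<in> strip d \<longleftrightarrow> \<zeta> \<in> strip d"
  by (simp add: strip_def)

lemma norm_increment_le:
  fixes f :: "real \<Rightarrow> 'a::real_normed_vector"
  assumes f: "\<And>x. (f has_vector_derivative f' x) (at x)"
    and \<phi>: "\<And>x. (\<phi> has_real_derivative p x) (at x)"
    and le: "\<And>x. norm (f' x) \<le> p x" and "x \<le> y"
  shows "norm (f y - f x) \<le> \<phi> y - \<phi> x"
proof (cases "x = y")
  case False
  with \<open>x \<le> y\<close> have "x < y" by simp
  then show ?thesis
  proof (rule differentiable_bound_general)
    show "continuous_on {x..y} f" "continuous_on {x..y} \<phi>"
      using f \<phi> by (auto intro!: continuous_at_imp_continuous_on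
          has_vector_derivative_continuous DERIV_isCont)
  qed (use f \<phi> le in \<open>auto simp: has_real_derivative_iff_has_vector_derivative\<close>)
qed auto

lemma norm_diff_limit_at_bot_le:
  fixes f :: "real \<Rightarrow> 'a::real_normed_vector"
  assumes f: "\<And>x. (f has_vector_derivative f' x) (at x)"
    and \<phi>: "\<And>x. (\<phi> has_real_derivative p x) (at x)"
    and le: "\<And>x. norm (f' x) \<le> p x"
    and lim: "(f \<longlongrightarrow> L) at_bot" "(\<phi> \<longlongrightarrow> l) at_bot"
  shows "norm (f x - L) \<le> \<phi> x - l"
proof (rule tendsto_le)
  show "((\<lambda>t. norm (f x - f t)) \<longlongrightarrow> norm (f x - L)) at_bot"
    by (intro tendsto_intros lim)
  show "((\<lambda>t. \<phi> x - \<phi> t) \<longlongrightarrow> \<phi> x - l) at_bot"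
    by (intro tendsto_intros lim)
  show "\<forall>\<^sub>F t in at_bot. norm (f x - f t) \<le> \<phi> x - \<phi> t"
    using eventually_le_at_bot[of x]
    by eventually_elim (rule norm_increment_le[OF f \<phi> le])
qed auto

lemma strip_horizontal_derivative:
  assumes "\<And>\<zeta>. \<zeta> \<in> strip d \<Longrightarrow> (F has_field_derivative f \<zeta>) (at \<zeta>)" and "\<bar>y\<bar> < d"
  shows "((\<lambda>x. F (Complex x y)) has_vector_derivative f (Complex x y)) (at x)"
proof -
  have "((\<lambda>x. Complex x y) has_vector_derivative 1) (at x)"
    unfolding Complex_eq by (auto intro!: derivative_eq_intros)
  moreover have "(F has_field_derivative f (Complex x y)) (at (Complex x y))"
    using assms by (auto simp: strip_def)
  ultimately show ?thesis
    using field_vector_diff_chain_at by (fastforce simp: o_def)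
qed

text \<open>Horizontal increments of \<open>F\<close> are dominated by those of
  \<open>\<phi>\<close>, which converges at minus infinity; the vertical oscillation at abscissa
  \<open>t\<close> is at most \<open>p t * \<bar>y\<bar>\<close>, which vanishes there. Hence all
  horizontal lines share the one limit \<open>L\<close>.\<close>

lemma strip_limit_at_bot:
  assumes "0 < d"
    and F: "\<And>\<zeta>. \<zeta> \<in> strip d \<Longrightarrow> (F has_field_derivative f \<zeta>) (at \<zeta>)"
    and le: "\<And>\<zeta>. \<zeta> \<in> strip d \<Longrightarrow> norm (f \<zeta>) \<le> p (Re \<zeta>)"
    and \<phi>: "\<And>x. (\<phi> has_real_derivative p x) (at x)"
    and lim: "(\<phi> \<longlongrightarrow> l) at_bot" "(p \<longlongrightarrow> 0) at_bot"
  obtains L where "\<And>\<zeta>. \<zeta> \<in> strip d \<Longrightarrow> norm (F \<zeta> - L) \<le> \<phi> (Re \<zeta>) - l"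
proof -
  have horiz: "norm (F (Complex x y) - F (Complex t y)) \<le> \<phi> x - \<phi> t" if "\<bar>y\<bar> < d" "t \<le> x" for x y t
    by (rule norm_increment_le[OF strip_horizontal_derivative[OF F] \<phi>])
      (use that in \<open>auto intro!: order.trans[OF le] simp: strip_def\<close>)
  have vert: "norm (F (Complex t y) - F (Complex t 0)) \<le> p t * \<bar>y\<bar>" if "\<bar>y\<bar> < d" for t y
  proof -
    \<comment> \<open>The line \<open>Re \<zeta> = t\<close> is written as two half planes cut with
      the strip: convexity is then immediate, and the derivative is bounded by the constant
      \<open>p t\<close> on it.\<close>
    have "norm (F (Complex t y) - F (Complex t 0)) \<le> p t * norm (Complex t y - Complex t 0)"
    proof (rule field_differentiable_bound[where S = "{\<zeta>. Re \<zeta> \<le> t} \<inter> {\<zeta>. Re \<zeta> \<ge> t} \<inter> strip d"])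
      show "convex ({\<zeta>. Re \<zeta> \<le> t} \<inter> {\<zeta>. Re \<zeta> \<ge> t} \<inter> strip d)"
        by (intro convex_Int convex_strip convex_halfspace_Re_le convex_halfspace_Re_ge)
    qed (use that \<open>0 < d\<close> F le in \<open>auto simp: strip_def intro: has_field_derivative_at_within\<close>)
    then show ?thesis by (simp add: cmod_def)
  qed
  \<comment> \<open>A sequence going left on the real axis suffices to find \<open>L\<close>, since
    its increments are controlled by those of the Cauchy sequence
    \<open>\<phi> (- real n)\<close>.\<close>
  define X where "X = (\<lambda>n. F (Complex (- real n) 0))"
  have at_bot: "filterlim (\<lambda>n. - real n) at_bot sequentially"
    by (simp add: filterlim_uminus_at_top filterlim_real_sequentially
        flip: filterlim_uminus_at_top)
  have "Cauchy (\<lambda>n. \<phi> (- real n))"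
    by (rule LIMSEQ_imp_Cauchy[OF filterlim_compose[OF lim(1) at_bot]])
  have X_dist: "dist (X m) (X n) \<le> dist (\<phi> (- real m)) (\<phi> (- real n))" for m n
    using horiz[of 0 "- real m" "- real n"] horiz[of 0 "- real n" "- real m"] \<open>0 < d\<close>
    unfolding X_def dist_norm by (cases "m \<le> n") (auto simp: norm_minus_commute)
  have "Cauchy X"
    using \<open>Cauchy (\<lambda>n. \<phi> (- real n))\<close> X_dist unfolding Cauchy_def
    by (meson le_less_trans)
  then obtain L where L: "X \<longlonglongrightarrow> L"
    using Cauchy_convergent convergent_def by blast
  show ?thesis
  proof
    fix \<zeta> assume \<zeta>: "\<zeta> \<in> strip d"
    define x y where "x = Re \<zeta>" and "y = Im \<zeta>"
    have y: "\<bar>y\<bar> < d" and \<zeta>_eq: "\<zeta> = Complex x y"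
      using \<zeta> by (auto simp: strip_def x_def y_def)
    \<comment> \<open>The path from \<open>\<zeta>\<close> runs horizontally to abscissa
      \<open>- n\<close> and then vertically to the real axis; \<open>0 * \<bar>y\<bar>\<close> is
      the limit of the vertical error.\<close>
    have "norm (F \<zeta> - L) \<le> \<phi> x - l + 0 * \<bar>y\<bar>"
    proof (rule tendsto_le)
      show "(\<lambda>n. norm (F \<zeta> - X n)) \<longlonglongrightarrow> norm (F \<zeta> - L)"
        by (intro tendsto_intros L)
      show "(\<lambda>n. \<phi> x - \<phi> (- real n) + p (- real n) * \<bar>y\<bar>) \<longlonglongrightarrow> \<phi> x - l + 0 * \<bar>y\<bar>"
        by (intro tendsto_intros filterlim_compose[OF lim(1) at_bot] filterlim_compose[OF lim(2) at_bot])
      show "\<forall>\<^sub>F n in sequentially. norm (F \<zeta> - X n) \<le> \<phi> x - \<phi> (- real n) + p (- real n) * \<bar>y\<bar>"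
        using eventually_compose_filterlim[OF eventually_le_at_bot[of x] at_bot]
      proof eventually_elim
        case (elim n)
        have "norm (F \<zeta> - X n) \<le> norm (F (Complex x y) - F (Complex (- real n) y))
            + norm (F (Complex (- real n) y) - F (Complex (- real n) 0))"
          unfolding X_def \<zeta>_eq by norm
        then show ?case
          using horiz[OF y elim] vert[OF y, of "- real n"] by linarith
      qed
    qed auto
    then show "norm (F \<zeta> - L) \<le> \<phi> (Re \<zeta>) - l"
      by (simp add: x_def)
  qed
qed

text \<open>Convexity supplies some primitive; subtracting its limit at minus infinity turns it into
  the integral from minus infinity.\<close>

lemma strip_primitive:
  assumes "0 < d" and hol: "f holomorphic_on strip d"
    and le: "\<And>\<zeta>. \<zeta> \<in> strip d \<Longrightarrow> norm (f \<zeta>) \<le> p (Re \<zeta>)"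
    and \<phi>: "\<And>x. (\<phi> has_real_derivative p x) (at x)"
    and lim: "(\<phi> \<longlongrightarrow> 0) at_bot" "(p \<longlongrightarrow> 0) at_bot"
  obtains F where "\<And>\<zeta>. \<zeta> \<in> strip d \<Longrightarrow> (F has_field_derivative f \<zeta>) (at \<zeta>)"
    and "\<And>\<zeta>. \<zeta> \<in> strip d \<Longrightarrow> norm (F \<zeta>) \<le> \<phi> (Re \<zeta>)"
proof -
  obtain G where "\<And>\<zeta>. \<zeta> \<in> strip d \<Longrightarrow> (G has_field_derivative f \<zeta>) (at \<zeta> within strip d)"
    using holomorphic_convex_primitive'[OF convex_strip open_strip hol] by blast
  then have G: "(G has_field_derivative f \<zeta>) (at \<zeta>)" if "\<zeta> \<in> strip d" for \<zeta>
    using that by (simp add: at_within_open[OF _ open_strip])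
  obtain L where L: "\<And>\<zeta>. \<zeta> \<in> strip d \<Longrightarrow> norm (G \<zeta> - L) \<le> \<phi> (Re \<zeta>) - 0"
    using strip_limit_at_bot[OF \<open>0 < d\<close> G le \<phi> lim] by blast
  show ?thesis
  proof
    show "((\<lambda>\<zeta>. G \<zeta> - L) has_field_derivative f \<zeta>) (at \<zeta>)" if "\<zeta> \<in> strip d" for \<zeta>
      using G[OF that] by (auto intro!: derivative_eq_intros)
  qed (use L in auto)
qed

subsection \<open>Linear systems with a majorant\<close>

text \<open>\<open>\<sigma>'\<close> is an integrable weight that will dominate all coefficients,
  \<open>\<sigma>\<close> its primitive from minus infinity and \<open>S\<close> its total mass. The
  limits at plus infinity serve the behaviour of the solution at the right endpoint.\<close>

locale majorant =
  fixes \<sigma> \<sigma>' :: "real \<Rightarrow> real" and S :: real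
  assumes deriv: "\<And>x. (\<sigma> has_real_derivative \<sigma>' x) (at x)"
    and \<sigma>_at_bot: "(\<sigma> \<longlongrightarrow> 0) at_bot" and \<sigma>'_at_bot: "(\<sigma>' \<longlongrightarrow> 0) at_bot"
    and \<sigma>_at_top: "(\<sigma> \<longlongrightarrow> S) at_top" and \<sigma>'_at_top: "(\<sigma>' \<longlongrightarrow> 0) at_top"
    and \<sigma>_nonneg: "\<And>x. 0 \<le> \<sigma> x" and \<sigma>_le: "\<And>x. \<sigma> x \<le> S" and \<sigma>'_nonneg: "\<And>x. 0 \<le> \<sigma>' x"
begin

text \<open>The \<open>k\<close>-fold iterated integral from minus infinity of the weight
  \<open>N * \<sigma>'\<close>. \<open>N\<close> will be the number of unknowns, because every row
  of the system has that many terms.\<close>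

definition picard_bound :: "real \<Rightarrow> nat \<Rightarrow> real \<Rightarrow> real" where
  "picard_bound N k x = (N * \<sigma> x) ^ k / fact k"

lemma picard_bound_0 [simp]: "picard_bound N 0 x = 1"
  by (simp add: picard_bound_def)

lemma picard_bound_deriv:
  "(picard_bound N (Suc k) has_real_derivative N * \<sigma>' x * picard_bound N k x) (at x)"
proof -
  have "((\<lambda>x. (N * \<sigma> x) ^ Suc k / fact (Suc k)) has_real_derivative
          ((1 + real k) * (N * \<sigma>' x * (N * \<sigma> x) ^ k)) / fact (Suc k)) (at x)"
    by (intro DERIV_cdivide DERIV_power_Suc DERIV_cmult deriv)
  then show ?thesis
    by (simp add: picard_bound_def[abs_def] fact_Suc)
qed

lemma picard_bound_Suc_at_bot: "(picard_bound N (Suc k) \<longlongrightarrow> 0) at_bot"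
proof -
  have "((\<lambda>x. (N * \<sigma> x) ^ Suc k / fact (Suc k)) \<longlongrightarrow> (N * 0) ^ Suc k / fact (Suc k)) at_bot"
    by (intro tendsto_intros \<sigma>_at_bot) auto
  then show ?thesis by (simp add: picard_bound_def[abs_def])
qed

lemma picard_bound_deriv_at_bot: "((\<lambda>x. c * \<sigma>' x * picard_bound N k x) \<longlongrightarrow> 0) at_bot"
proof -
  have "((\<lambda>x. c * \<sigma>' x * ((N * \<sigma> x) ^ k / fact k)) \<longlongrightarrow> c * 0 * ((N * 0) ^ k / fact k)) at_bot"
    by (intro tendsto_intros \<sigma>_at_bot \<sigma>'_at_bot) auto
  then show ?thesis by (simp add: picard_bound_def[abs_def])
qed

text \<open>One factor \<open>\<sigma> x\<close> is kept and the others are bounded by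
  \<open>S\<close>: the kept factor makes the summed series vanish at minus infinity, and the rest
  is a term of the series for \<open>exp (N * S)\<close>, independent of \<open>x\<close>.\<close>

lemma picard_bound_Suc_le:
  assumes "0 \<le> N"
  shows "picard_bound N (Suc k) x \<le> N * \<sigma> x * ((N * S) ^ k /\<^sub>R fact k)"
proof -
  have "(N * \<sigma> x) ^ k / fact (Suc k) \<le> (N * S) ^ k / fact k"
    using assms \<sigma>_nonneg \<sigma>_le fact_mono[of k "Suc k", where 'a = real]
    by (intro frac_le power_mono mult_left_mono mult_nonneg_nonneg zero_le_power
        order.trans[OF \<sigma>_nonneg \<sigma>_le]) (auto intro: order.trans[OF \<sigma>_nonneg \<sigma>_le])
  then have "N * \<sigma> x * ((N * \<sigma> x) ^ k / fact (Suc k)) \<le> N * \<sigma> x * ((N * S) ^ k / fact k)"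
    using assms \<sigma>_nonneg by (intro mult_left_mono mult_nonneg_nonneg)
  then show ?thesis
    by (simp add: picard_bound_def divide_inverse mult_ac scaleR_conv_of_real)
qed

text \<open>Integrating the equation from minus infinity improves the bound
  \<open>B * picard_bound N k\<close> to the one for \<open>Suc k\<close>; starting from the
  constant \<open>B\<close>, these bounds tend to zero because of the factorial.\<close>

lemma homogeneous_system_zero:
  fixes A :: "'n::finite \<Rightarrow> 'n \<Rightarrow> real \<Rightarrow> complex" and E :: "'n \<Rightarrow> real \<Rightarrow> complex"
  assumes E: "\<And>i x. (E i has_vector_derivative (\<Sum>j\<in>UNIV. A i j x * E j x)) (at x)"
    and A: "\<And>i j x. norm (A i j x) \<le> \<sigma>' x"
    and lim: "\<And>i. (E i \<longlongrightarrow> 0) at_bot"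
    and B: "\<And>i x. norm (E i x) \<le> B"
  shows "E i x = 0"
proof -
  define N where "N = real CARD('n)"
  have iter: "norm (E i x) \<le> B * picard_bound N k x" for i x k
  proof (induction k arbitrary: i x)
    case (Suc k)
    have "norm (E i x - 0) \<le> B * picard_bound N (Suc k) x - B * 0"
    proof (rule norm_diff_limit_at_bot_le[OF E])
      show "((\<lambda>x. B * picard_bound N (Suc k) x) has_real_derivative
              B * (N * \<sigma>' x * picard_bound N k x)) (at x)" for x
        by (rule derivative_eq_intros picard_bound_deriv refl)+ simp
      show "norm (\<Sum>j\<in>UNIV. A i j x * E j x) \<le> B * (N * \<sigma>' x * picard_bound N k x)" for x
      proof -
        have "norm (\<Sum>j\<in>UNIV. A i j x * E j x) \<le> (\<Sum>j\<in>(UNIV::'n set). \<sigma>' x * (B * picard_bound N k x))"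
          by (rule sum_norm_le) (auto simp: norm_mult intro!: mult_mono A Suc.IH \<sigma>'_nonneg)
        then show ?thesis by (simp add: N_def mult_ac)
      qed
      show "((\<lambda>x. B * picard_bound N (Suc k) x) \<longlongrightarrow> B * 0) at_bot"
        by (intro tendsto_intros picard_bound_Suc_at_bot)
    qed (rule lim)
    then show ?case by simp
  qed (use B in auto)
  have "(\<lambda>k. picard_bound N k x) \<longlonglongrightarrow> 0"
    unfolding picard_bound_def
    using summable_LIMSEQ_zero[OF summable_exp[of "N * \<sigma> x"]] by (simp add: field_simps)
  then have "(\<lambda>k. B * picard_bound N k x) \<longlonglongrightarrow> B * 0"
    by (intro tendsto_intros)
  then have "norm (E i x) \<le> B * 0"
    by (rule LIMSEQ_le_const) (use iter in auto)
  then show ?thesis by simp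
qed

section \<open>Picard iteration on the strip\<close>

lemma picard_step:
  fixes f :: "'n \<Rightarrow> complex \<Rightarrow> complex"
  assumes "0 < d" "0 < N" and hol: "\<And>i. f i holomorphic_on strip d"
    and le: "\<And>i \<zeta>. \<zeta> \<in> strip d \<Longrightarrow> norm (f i \<zeta>) \<le> B * \<sigma>' (Re \<zeta>) * picard_bound N k (Re \<zeta>)"
  shows "\<exists>w. \<forall>i. \<forall>\<zeta>\<in>strip d. (w i has_field_derivative f i \<zeta>) (at \<zeta>) \<and>
           norm (w i \<zeta>) \<le> B / N * picard_bound N (Suc k) (Re \<zeta>)"
proof (rule choice, rule)
  fix i
  \<comment> \<open>The divisor \<open>N\<close> compensates the factor \<open>N\<close> produced by
    \<open>picard_bound_deriv\<close>, so that the derivative is exactly the bound given for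
    \<open>f i\<close>.\<close>
  have "((\<lambda>x. B / N * picard_bound N (Suc k) x) has_real_derivative
          B * \<sigma>' x * picard_bound N k x) (at x)" for x
    by (rule derivative_eq_intros picard_bound_deriv refl)+ (use \<open>0 < N\<close> in simp)
  moreover have "((\<lambda>x. B / N * picard_bound N (Suc k) x) \<longlongrightarrow> 0) at_bot"
    using tendsto_mult_left[OF picard_bound_Suc_at_bot, of "B / N"] by simp
  ultimately obtain F where "\<And>\<zeta>. \<zeta> \<in> strip d \<Longrightarrow> (F has_field_derivative f i \<zeta>) (at \<zeta>)"
    and "\<And>\<zeta>. \<zeta> \<in> strip d \<Longrightarrow> norm (F \<zeta>) \<le> B / N * picard_bound N (Suc k) (Re \<zeta>)"
    using strip_primitive[OF \<open>0 < d\<close> hol le _ _ picard_bound_deriv_at_bot] by (smt (verit))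
  then show "\<exists>w. \<forall>\<zeta>\<in>strip d. (w has_field_derivative f i \<zeta>) (at \<zeta>) \<and>
      norm (w \<zeta>) \<le> B / N * picard_bound N (Suc k) (Re \<zeta>)"
    by blast
qed

text \<open>Each integration yields primitives by an existence statement, so the iterates are built
  by dependent choice. The term \<open>v 0\<close> is already one integral of \<open>f\<close>,
  which is why \<open>v k\<close> is bounded with index \<open>Suc k\<close>.\<close>

lemma picard_terms:
  fixes A :: "'n::finite \<Rightarrow> 'n \<Rightarrow> complex \<Rightarrow> complex" and f :: "'n \<Rightarrow> complex \<Rightarrow> complex"
  assumes "0 < d" and A: "\<And>i j. A i j holomorphic_on strip d"
    and f: "\<And>i. f i holomorphic_on strip d"
    and A_le: "\<And>i j \<zeta>. \<zeta> \<in> strip d \<Longrightarrow> norm (A i j \<zeta>) \<le> \<sigma>' (Re \<zeta>)"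
    and f_le: "\<And>i \<zeta>. \<zeta> \<in> strip d \<Longrightarrow> norm (f i \<zeta>) \<le> B * \<sigma>' (Re \<zeta>)"
  shows "\<exists>v :: nat \<Rightarrow> 'n \<Rightarrow> complex \<Rightarrow> complex.
    (\<forall>i. \<forall>\<zeta>\<in>strip d. (v 0 i has_field_derivative f i \<zeta>) (at \<zeta>)) \<and>
    (\<forall>k i. \<forall>\<zeta>\<in>strip d. (v (Suc k) i has_field_derivative (\<Sum>j\<in>UNIV. A i j \<zeta> * v k j \<zeta>)) (at \<zeta>)) \<and>
    (\<forall>k i. \<forall>\<zeta>\<in>strip d. norm (v k i \<zeta>) \<le> B / CARD('n) * picard_bound CARD('n) (Suc k) (Re \<zeta>))"
proof -
  define N where "N = real CARD('n)"
  have "0 < N" by (simp add: N_def)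
  \<comment> \<open>\<open>P\<close> is the invariant of the choice: holomorphy and the bound permit
    the next integration, and the clause for \<open>k = 0\<close> records that the first term
    integrates \<open>f\<close>.\<close>
  define P where "P = (\<lambda>k (w::'n \<Rightarrow> complex \<Rightarrow> complex). (\<forall>i. w i holomorphic_on strip d) \<and>
      (\<forall>i. \<forall>\<zeta>\<in>strip d. norm (w i \<zeta>) \<le> B / N * picard_bound N (Suc k) (Re \<zeta>)) \<and>
      (k = 0 \<longrightarrow> (\<forall>i. \<forall>\<zeta>\<in>strip d. (w i has_field_derivative f i \<zeta>) (at \<zeta>))))"
  define Q where "Q = (\<lambda>w w' :: 'n \<Rightarrow> complex \<Rightarrow> complex. \<forall>i. \<forall>\<zeta>\<in>strip d.
      (w' i has_field_derivative (\<Sum>j\<in>UNIV. A i j \<zeta> * w j \<zeta>)) (at \<zeta>))"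
  have hol: "g holomorphic_on strip d"
    if "\<And>\<zeta>. \<zeta> \<in> strip d \<Longrightarrow> (g has_field_derivative g' \<zeta>) (at \<zeta>)" for g g'
    using that by (auto simp: holomorphic_on_open[OF open_strip])
  have "\<exists>v. \<forall>k. P k (v k) \<and> Q (v k) (v (Suc k))"
  proof (rule dependent_nat_choice[of P "\<lambda>_. Q"])
    obtain w where "\<forall>i. \<forall>\<zeta>\<in>strip d. (w i has_field_derivative f i \<zeta>) (at \<zeta>) \<and>
        norm (w i \<zeta>) \<le> B / N * picard_bound N (Suc 0) (Re \<zeta>)"
      using picard_step[where f = f and B = B and k = 0, OF \<open>0 < d\<close> \<open>0 < N\<close>] f f_le by auto
    then show "\<exists>w. P 0 w"
      unfolding P_def by (intro exI[of _ w]) (auto intro!: hol)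
  next
    fix w k assume w: "P k w"
    have "(\<lambda>\<zeta>. \<Sum>j\<in>UNIV. A i j \<zeta> * w j \<zeta>) holomorphic_on strip d" for i
      using w A by (intro holomorphic_intros) (auto simp: P_def)
    moreover have "norm (\<Sum>j\<in>UNIV. A i j \<zeta> * w j \<zeta>) \<le> B * \<sigma>' (Re \<zeta>) * picard_bound N (Suc k) (Re \<zeta>)"
      if \<zeta>: "\<zeta> \<in> strip d" for i \<zeta>
    proof -
      \<comment> \<open>The sum has \<open>N\<close> terms carrying the constant
        \<open>B / N\<close>, so the same \<open>B\<close> is passed on to the next step.\<close>
      have "norm (\<Sum>j\<in>UNIV. A i j \<zeta> * w j \<zeta>)
          \<le> (\<Sum>j\<in>(UNIV::'n set). \<sigma>' (Re \<zeta>) * (B / N * picard_bound N (Suc k) (Re \<zeta>)))"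
        using w \<zeta> unfolding P_def norm_mult
        by (intro sum_norm_le) (auto simp: norm_mult simp del: times_divide_eq_left
            intro!: mult_mono A_le \<sigma>'_nonneg)
      then show ?thesis using \<open>0 < N\<close> by (simp add: mult_ac flip: N_def)
    qed
    ultimately obtain w' where "\<forall>i. \<forall>\<zeta>\<in>strip d.
        (w' i has_field_derivative (\<Sum>j\<in>UNIV. A i j \<zeta> * w j \<zeta>)) (at \<zeta>) \<and>
        norm (w' i \<zeta>) \<le> B / N * picard_bound N (Suc (Suc k)) (Re \<zeta>)"
      using picard_step[where f = "\<lambda>i \<zeta>. \<Sum>j\<in>UNIV. A i j \<zeta> * w j \<zeta>"
          and B = B and k = "Suc k", OF \<open>0 < d\<close> \<open>0 < N\<close>] by blast
    then show "\<exists>w'. P (Suc k) w' \<and> Q w w'"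
      unfolding P_def Q_def by (intro exI[of _ w']) (auto intro!: hol)
  qed
  then obtain v where "\<And>k. P k (v k)" "\<And>k. Q (v k) (v (Suc k))"
    by blast
  then show ?thesis
    by (intro exI[of _ v]) (auto simp: P_def Q_def N_def)
qed

text \<open>The unknown is split as \<open>r\<close> plus a part \<open>g\<close> vanishing at minus
  infinity, which solves the system with inhomogeneity \<open>f\<close>, that is \<open>A\<close>
  applied to \<open>r\<close> plus \<open>h\<close>. This \<open>g\<close> is the sum of the Picard
  terms, differentiated termwise.\<close>

lemma strip_system_solution:
  fixes A :: "'n::finite \<Rightarrow> 'n \<Rightarrow> complex \<Rightarrow> complex" and h :: "'n \<Rightarrow> complex \<Rightarrow> complex"
  assumes "0 < d" and A: "\<And>i j. A i j holomorphic_on strip d"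
    and h: "\<And>i. h i holomorphic_on strip d"
    and A_le: "\<And>i j \<zeta>. \<zeta> \<in> strip d \<Longrightarrow> norm (A i j \<zeta>) \<le> \<sigma>' (Re \<zeta>)"
    and h_le: "\<And>i \<zeta>. \<zeta> \<in> strip d \<Longrightarrow> norm (h i \<zeta>) \<le> \<sigma>' (Re \<zeta>)"
  shows "\<exists>u C. 0 \<le> C \<and> (\<forall>i. \<forall>\<zeta>\<in>strip d.
    (u i has_field_derivative (\<Sum>j\<in>UNIV. A i j \<zeta> * u j \<zeta>) + h i \<zeta>) (at \<zeta>) \<and>
    norm (u i \<zeta> - r i) \<le> C * \<sigma> (Re \<zeta>))"
proof -
  define N where "N = real CARD('n)"
  define R where "R = (\<Sum>i\<in>UNIV. norm (r i))"
  \<comment> \<open>In units of \<open>\<sigma>'\<close>, the sum of the \<open>N\<close> products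
    of \<open>A\<close> with \<open>r\<close> contributes \<open>N * R\<close> and \<open>h\<close>
    contributes \<open>1\<close>.\<close>
  define B where "B = N * R + 1"
  have "0 < N" "0 \<le> R" by (auto simp: N_def R_def sum_nonneg)
  then have "0 \<le> B" by (auto simp: B_def)
  have r_le: "norm (r i) \<le> R" for i
    unfolding R_def by (rule member_le_sum) auto
  define f where "f = (\<lambda>i \<zeta>. (\<Sum>j\<in>UNIV. A i j \<zeta> * r j) + h i \<zeta>)"
  have f_hol: "f i holomorphic_on strip d" for i
    unfolding f_def by (intro holomorphic_intros A h)
  have f_le: "norm (f i \<zeta>) \<le> B * \<sigma>' (Re \<zeta>)" if "\<zeta> \<in> strip d" for i \<zeta>
  proof -
    have "norm (\<Sum>j\<in>UNIV. A i j \<zeta> * r j) \<le> (\<Sum>j\<in>(UNIV::'n set). \<sigma>' (Re \<zeta>) * R)"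
      by (rule sum_norm_le) (auto simp: norm_mult intro!: mult_mono A_le r_le \<sigma>'_nonneg that)
    then show ?thesis
      using norm_triangle_mono[OF _ h_le[OF that, of i]]
      by (fastforce simp: f_def B_def N_def algebra_simps)
  qed
  have "\<exists>v :: nat \<Rightarrow> 'n \<Rightarrow> complex \<Rightarrow> complex.
     (\<forall>i. \<forall>\<zeta>\<in>strip d. (v 0 i has_field_derivative f i \<zeta>) (at \<zeta>)) \<and>
     (\<forall>k i. \<forall>\<zeta>\<in>strip d. (v (Suc k) i has_field_derivative (\<Sum>j\<in>UNIV. A i j \<zeta> * v k j \<zeta>)) (at \<zeta>)) \<and>
     (\<forall>k i. \<forall>\<zeta>\<in>strip d. norm (v k i \<zeta>) \<le> B / N * picard_bound N (Suc k) (Re \<zeta>))"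
    unfolding N_def by (rule picard_terms[OF \<open>0 < d\<close> A f_hol A_le f_le])
  then obtain v :: "nat \<Rightarrow> 'n \<Rightarrow> complex \<Rightarrow> complex" where v:
     "(\<forall>i. \<forall>\<zeta>\<in>strip d. (v 0 i has_field_derivative f i \<zeta>) (at \<zeta>)) \<and>
     (\<forall>k i. \<forall>\<zeta>\<in>strip d. (v (Suc k) i has_field_derivative (\<Sum>j\<in>UNIV. A i j \<zeta> * v k j \<zeta>)) (at \<zeta>)) \<and>
     (\<forall>k i. \<forall>\<zeta>\<in>strip d. norm (v k i \<zeta>) \<le> B / N * picard_bound N (Suc k) (Re \<zeta>))"
    by (elim exE)
  have v_deriv_0: "(v 0 i has_field_derivative f i \<zeta>) (at \<zeta>)"
    and v_deriv_Suc: "(v (Suc k) i has_field_derivative (\<Sum>j\<in>UNIV. A i j \<zeta> * v k j \<zeta>)) (at \<zeta>)"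
    and v_le: "norm (v k i \<zeta>) \<le> B / N * picard_bound N (Suc k) (Re \<zeta>)"
    if "\<zeta> \<in> strip d" for k i \<zeta>
    using v that by auto
  \<comment> \<open>The derivatives of the Picard terms as one sequence: the index is shifted, since
    term \<open>Suc k\<close> integrates \<open>A\<close> applied to term \<open>k\<close>.\<close>
  define D where "D = (\<lambda>i k \<zeta>. case k of 0 \<Rightarrow> f i \<zeta> | Suc k \<Rightarrow> \<Sum>j\<in>UNIV. A i j \<zeta> * v k j \<zeta>)"
  have v_deriv: "(v k i has_field_derivative D i k \<zeta>) (at \<zeta>)" if "\<zeta> \<in> strip d" for k i \<zeta>
    using v_deriv_0 v_deriv_Suc that by (auto simp: D_def split: nat.split)
  have v_le': "norm (v k i \<zeta>) \<le> B * \<sigma> (Re \<zeta>) * ((N * S) ^ k /\<^sub>R fact k)" if "\<zeta> \<in> strip d" for k i \<zeta>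
  proof -
    note v_le[OF that, of k i]
    also have "B / N * picard_bound N (Suc k) (Re \<zeta>) \<le> B / N * (N * \<sigma> (Re \<zeta>) * ((N * S) ^ k /\<^sub>R fact k))"
      using \<open>0 \<le> B\<close> \<open>0 < N\<close> by (intro mult_left_mono picard_bound_Suc_le) auto
    also have "\<dots> = B * \<sigma> (Re \<zeta>) * ((N * S) ^ k /\<^sub>R fact k)"
      using \<open>0 < N\<close> by simp
    finally show ?thesis .
  qed
  have exp_sums: "(\<lambda>k. c * ((N * S) ^ k /\<^sub>R fact k)) sums (c * exp (N * S))" for c
    by (intro sums_mult exp_converges)
  have "0 \<le> S" using \<sigma>_nonneg[of 0] \<sigma>_le[of 0] by simp
  \<comment> \<open>Termwise differentiation needs a summable bound independent of
    \<open>\<zeta>\<close>; the sharper \<open>v_le'\<close> retains \<open>\<sigma>\<close> for the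
    final estimate.\<close>
  have v_le_S: "norm (v k i \<zeta>) \<le> B * S * ((N * S) ^ k /\<^sub>R fact k)" if "\<zeta> \<in> strip d" for k i \<zeta>
    using \<open>0 \<le> B\<close> \<open>0 < N\<close> \<open>0 \<le> S\<close>
    by (intro order.trans[OF v_le'[OF that]] mult_right_mono mult_left_mono \<sigma>_le) auto
  have "\<exists>g g'. \<forall>\<zeta>\<in>strip d. (\<lambda>k. v k i \<zeta>) sums g \<zeta> \<and> (\<lambda>k. D i k \<zeta>) sums g' \<zeta> \<and>
      (g has_field_derivative g' \<zeta>) (at \<zeta>)" for i
  proof -
    have "\<forall>\<^sub>F k in sequentially. \<forall>\<zeta>\<in>strip d. norm (v k i \<zeta>) \<le> B * S * ((N * S) ^ k /\<^sub>R fact k)"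
      using v_le_S by (intro always_eventually) blast
    with series_and_derivative_comparison[where f = "\<lambda>k. v k i" and f' = "D i",
        OF open_strip sums_summable[OF exp_sums] v_deriv]
    show ?thesis by blast
  qed
  then obtain g g' where g: "\<And>i \<zeta>. \<zeta> \<in> strip d \<Longrightarrow> (\<lambda>k. v k i \<zeta>) sums g i \<zeta>"
    and g': "\<And>i \<zeta>. \<zeta> \<in> strip d \<Longrightarrow> (\<lambda>k. D i k \<zeta>) sums g' i \<zeta>"
    and g_deriv: "\<And>i \<zeta>. \<zeta> \<in> strip d \<Longrightarrow> (g i has_field_derivative g' i \<zeta>) (at \<zeta>)"
    by metis
  have g'_eq: "g' i \<zeta> = (\<Sum>j\<in>UNIV. A i j \<zeta> * g j \<zeta>) + f i \<zeta>" if \<zeta>: "\<zeta> \<in> strip d" for i \<zeta>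
  proof -
    have "(\<lambda>k. \<Sum>j\<in>UNIV. A i j \<zeta> * v k j \<zeta>) sums (\<Sum>j\<in>UNIV. A i j \<zeta> * g j \<zeta>)"
      by (intro sums_sum sums_mult g \<zeta>)
    then have "(\<lambda>k. D i (Suc k) \<zeta>) sums (\<Sum>j\<in>UNIV. A i j \<zeta> * g j \<zeta>)"
      by (simp add: D_def)
    \<comment> \<open>Prepending the term of index \<open>0\<close> adds the inhomogeneity
      \<open>f\<close>.\<close>
    from sums_Suc[OF this] have "(\<lambda>k. D i k \<zeta>) sums ((\<Sum>j\<in>UNIV. A i j \<zeta> * g j \<zeta>) + f i \<zeta>)"
      by (simp add: D_def)
    then show ?thesis using g'[OF \<zeta>] sums_unique2 by blast
  qed
  show ?thesis
  proof (intro exI[of _ "\<lambda>i \<zeta>. r i + g i \<zeta>"] exI[of _ "B * exp (N * S)"] conjI allI ballI)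
    fix i \<zeta> assume \<zeta>: "\<zeta> \<in> strip d"
    have "((\<lambda>\<zeta>. r i + g i \<zeta>) has_field_derivative g' i \<zeta>) (at \<zeta>)"
      using g_deriv[OF \<zeta>] by (auto intro!: derivative_eq_intros)
    also have "g' i \<zeta> = (\<Sum>j\<in>UNIV. A i j \<zeta> * (r j + g j \<zeta>)) + h i \<zeta>"
      by (simp add: g'_eq[OF \<zeta>] f_def distrib_left sum.distrib)
    finally show "((\<lambda>\<zeta>. r i + g i \<zeta>) has_field_derivative
        (\<Sum>j\<in>UNIV. A i j \<zeta> * (r j + g j \<zeta>)) + h i \<zeta>) (at \<zeta>)" .
    have "norm (g i \<zeta>) \<le> B * \<sigma> (Re \<zeta>) * exp (N * S)"
      unfolding sums_unique[OF g[OF \<zeta>]] sums_unique[OF exp_sums]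
      by (intro norm_suminf_le v_le' sums_summable[OF exp_sums] \<zeta>)
    then show "norm ((r i + g i \<zeta>) - r i) \<le> B * exp (N * S) * \<sigma> (Re \<zeta>)"
      by (simp add: mult_ac)
  qed (use \<open>0 \<le> B\<close> in simp)
qed

text \<open>The strip is symmetric under negation, which turns the limit on the right into one on
  the left; the reflected majorant \<open>- (C * \<sigma> (- x))\<close> starts from
  \<open>- (C * S)\<close>.\<close>

lemma strip_limit_at_top:
  assumes "0 < d"
    and F: "\<And>\<zeta>. \<zeta> \<in> strip d \<Longrightarrow> (F has_field_derivative f \<zeta>) (at \<zeta>)"
    and le: "\<And>\<zeta>. \<zeta> \<in> strip d \<Longrightarrow> norm (f \<zeta>) \<le> C * \<sigma>' (Re \<zeta>)"
  shows "\<exists>U. \<forall>\<zeta>\<in>strip d. norm (U - F \<zeta>) \<le> C * (S - \<sigma> (Re \<zeta>))"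
proof -
  have F_minus: "((\<lambda>\<zeta>. F (- \<zeta>)) has_field_derivative - f (- \<zeta>)) (at \<zeta>)" if "\<zeta> \<in> strip d" for \<zeta>
    using DERIV_chain'[OF DERIV_minus[OF DERIV_ident] F[of "- \<zeta>"]] that
    by (simp add: uminus_strip_iff)
  have "((\<lambda>x. - (C * \<sigma> (- x))) has_real_derivative C * \<sigma>' (- x)) (at x)" for x
    using DERIV_minus[OF DERIV_cmult[OF DERIV_chain'[OF DERIV_minus[OF DERIV_ident] deriv[of "- x"]], of C]]
    by simp
  moreover have "((\<lambda>x. - (C * \<sigma> (- x))) \<longlongrightarrow> - (C * S)) at_bot"
    by (intro tendsto_intros filterlim_compose[OF \<sigma>_at_top filterlim_uminus_at_top_at_bot])
  moreover have "((\<lambda>x. C * \<sigma>' (- x)) \<longlongrightarrow> 0) at_bot"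
    using tendsto_mult_left[OF filterlim_compose[OF \<sigma>'_at_top filterlim_uminus_at_top_at_bot], of C]
    by simp
  moreover have "norm (- f (- \<zeta>)) \<le> C * \<sigma>' (- Re \<zeta>)" if "\<zeta> \<in> strip d" for \<zeta>
    using le[of "- \<zeta>"] that by (simp add: uminus_strip_iff)
  ultimately obtain U where U: "\<And>\<zeta>. \<zeta> \<in> strip d \<Longrightarrow>
      norm (F (- \<zeta>) - U) \<le> - (C * \<sigma> (- Re \<zeta>)) - - (C * S)"
    using strip_limit_at_bot[OF \<open>0 < d\<close> F_minus, of "\<lambda>x. C * \<sigma>' (- x)" "\<lambda>x. - (C * \<sigma> (- x))"]
    by blast
  show ?thesis
  proof (intro exI ballI)
    show "norm (U - F \<zeta>) \<le> C * (S - \<sigma> (Re \<zeta>))" if "\<zeta> \<in> strip d" for \<zeta>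
      using U[of "- \<zeta>"] that by (simp add: uminus_strip_iff norm_minus_commute algebra_simps)
  qed
qed

end

subsection \<open>The SE transformation\<close>

lemma norm_one_plus_exp_le: "norm (1 + exp \<zeta>) \<le> 1 + exp (Re \<zeta>)"
  using norm_triangle_ineq[of 1 "exp \<zeta>"] by simp

text \<open>Together with \<open>norm_one_plus_exp_le\<close> this makes
  \<open>1 + exp \<zeta>\<close> comparable with its value at \<open>Re \<zeta>\<close>, uniformly
  on the strip; \<open>d < pi\<close> keeps its zeros, the odd multiples of
  \<open>pi * \<i>\<close>, at a distance.\<close>

lemma norm_one_plus_exp_ge:
  assumes "\<zeta> \<in> strip d" "d < pi"
  shows "cos (d / 2) * (1 + exp (Re \<zeta>)) \<le> norm (1 + exp \<zeta>)"
proof -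
  define x y where "x = Re \<zeta>" and "y = Im \<zeta>"
  have y: "\<bar>y\<bar> < d" using assms by (simp add: strip_def y_def)
  have "cos (d / 2) \<le> cos (\<bar>y\<bar> / 2)"
    using y assms by (subst cos_mono_le_eq) auto
  then have "cos (d / 2) * (1 + exp x) \<le> cos (y / 2) * (1 + exp x)"
    by (intro mult_right_mono) (auto simp: abs_if split: if_splits)
  \<comment> \<open>Multiplying by the unimodular \<open>cis (- y / 2)\<close> gives both summands the argument \<open>\<plusminus> y / 2\<close>.\<close>
  also have "\<dots> = Re (cis (- (y / 2)) * (1 + exp \<zeta>))"
  proof -
    have "cis (- (y / 2)) * exp \<zeta> = exp x * cis (y / 2)"
      by (simp add: exp_eq_polar x_def y_def cis_mult mult.left_commute)
    then show ?thesis by (simp add: distrib_left algebra_simps)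
  qed
  also have "\<dots> \<le> norm (1 + exp \<zeta>)"
    using complex_Re_le_cmod[of "cis (- (y / 2)) * (1 + exp \<zeta>)"] by (simp add: norm_mult)
  finally show ?thesis by (simp add: x_def)
qed

lemma cos_half_pos: "0 < d \<Longrightarrow> d < pi \<Longrightarrow> 0 < cos (d / 2)"
  by (rule cos_gt_zero_pi) auto

lemma one_plus_exp_nonzero:
  assumes "\<zeta> \<in> strip d" "d < pi"
  shows "1 + exp \<zeta> \<noteq> 0" "1 + exp (- \<zeta>) \<noteq> 0"
proof -
  have nz: "1 + exp \<xi> \<noteq> 0" if "\<xi> \<in> strip d" for \<xi>
  proof -
    have "0 < d" using that by (auto simp: strip_def)
    then have "0 < cos (d / 2) * (1 + exp (Re \<xi>))"
      using \<open>d < pi\<close> by (intro mult_pos_pos cos_half_pos add_pos_pos) auto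
    then show ?thesis
      using norm_one_plus_exp_ge[OF that \<open>d < pi\<close>] by auto
  qed
  show "1 + exp \<zeta> \<noteq> 0" "1 + exp (- \<zeta>) \<noteq> 0"
    using nz[of \<zeta>] nz[of "- \<zeta>"] assms by (auto simp: uminus_strip_iff)
qed

text \<open>Since \<open>(1 + tanh (\<zeta> / 2)) / 2\<close> is the logistic function, distances to
  the endpoints become quotients by \<open>1 + exp (- \<zeta>)\<close> and
  \<open>1 + exp \<zeta>\<close>, which have two-sided estimates.\<close>

lemma psi_SE_minus_a:
  assumes "1 + exp (- \<zeta>) \<noteq> 0"
  shows "psi_SE a b \<zeta> - of_real a = of_real (b - a) / (1 + exp (- \<zeta>))"
proof -
  define e where "e = exp (\<zeta> / 2)"
  have "e \<noteq> 0" by (simp add: e_def)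
  have "exp (- \<zeta>) = inverse e ^ 2"
    unfolding e_def by (simp add: exp_minus power_inverse flip: exp_of_nat_mult exp_double)
  then have exp: "1 + exp (- \<zeta>) = (e + inverse e) / e"
    using \<open>e \<noteq> 0\<close> by (simp add: power2_eq_square add_divide_distrib inverse_eq_divide)
  then have "e + inverse e \<noteq> 0"
    using assms by auto
  moreover define s where "s = e + inverse e"
  ultimately have "s \<noteq> 0" by simp
  have "tanh (\<zeta> / 2) = (2 * e - s) / s"
    by (simp add: tanh_altdef e_def s_def exp_minus)
  then have "(1 + tanh (\<zeta> / 2)) / 2 = 1 / (1 + exp (- \<zeta>))"
    using \<open>s \<noteq> 0\<close> unfolding exp s_def[symmetric] by (simp add: diff_divide_distrib)
  moreover have "psi_SE a b \<zeta> - of_real a = of_real (b - a) * ((1 + tanh (\<zeta> / 2)) / 2)"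
    by (simp add: psi_SE_def field_simps)
  ultimately show ?thesis by (simp only: times_divide_eq_right mult_1_right)
qed

lemma b_minus_psi_SE:
  assumes "1 + exp \<zeta> \<noteq> 0" "1 + exp (- \<zeta>) \<noteq> 0"
  shows "of_real b - psi_SE a b \<zeta> = of_real (b - a) / (1 + exp \<zeta>)"
proof -
  have "of_real b - psi_SE a b \<zeta> = of_real (b - a) - of_real (b - a) / (1 + exp (- \<zeta>))"
    using psi_SE_minus_a[OF assms(2), of a b] by (simp add: algebra_simps)
  also have "\<dots> = of_real (b - a) / (1 + exp \<zeta>)"
    using assms by (simp add: exp_minus field_simps)
  finally show ?thesis .
qed

text \<open>The quotient equals \<open>exp \<zeta>\<close> at \<open>z = psi_SE a b \<zeta>\<close>,
  and the principal logarithm recovers \<open>\<zeta>\<close> as long as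
  \<open>\<bar>Im \<zeta>\<bar> < pi\<close>.\<close>

definition SE_inv :: "real \<Rightarrow> real \<Rightarrow> complex \<Rightarrow> complex" where
  "SE_inv a b z = Ln ((z - of_real a) / (of_real b - z))"

text \<open>This direction rests on \<open>exp (Ln w) = w\<close> for nonzero \<open>w\<close>; the
  excluded points are the zero and the pole of the quotient.\<close>

lemma psi_SE_SE_inv:
  assumes ab: "a < b" and "z \<noteq> of_real a" "z \<noteq> of_real b"
  shows "psi_SE a b (SE_inv a b z) = z"
proof -
  define w where "w = (z - of_real a) / (of_real b - z)"
  have "w \<noteq> 0" using assms by (simp add: w_def)
  then have e: "exp (SE_inv a b z) = w" by (simp add: SE_inv_def w_def)
  have "of_real b - of_real a \<noteq> (0::complex)"
    using ab by (simp flip: of_real_diff)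
  then have eq: "1 + inverse w = of_real (b - a) / (z - of_real a)" and "1 + inverse w \<noteq> 0"
    using assms by (auto simp: w_def field_simps)
  then have "psi_SE a b (SE_inv a b z) - of_real a = of_real (b - a) / (1 + inverse w)"
    using psi_SE_minus_a[of "SE_inv a b z" a b] by (simp add: exp_minus e)
  also have "\<dots> = z - of_real a"
    unfolding eq using \<open>1 + inverse w \<noteq> 0\<close> eq by (auto simp del: of_real_diff)
  finally show ?thesis by simp
qed

text \<open>\<open>1 + exp t\<close> is at most twice the larger of its summands, and
  \<open>\<alpha> \<le> 1\<close> gives \<open>2 powr \<alpha> \<le> 2\<close>.\<close>

lemma one_plus_exp_powr_le:
  fixes t :: real
  assumes "0 < \<alpha>" "\<alpha> \<le> 1"
  shows "(1 + exp t) powr \<alpha> \<le> 2 * (1 + exp (\<alpha> * t))"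
proof -
  have two: "2 powr \<alpha> \<le> (2::real)" using assms powr_mono[of \<alpha> 1 2] by simp
  have "(1 + exp t) powr \<alpha> \<le> (2 * exp (max 0 t)) powr \<alpha>"
    using assms by (intro powr_mono2) (auto simp: max_def)
  also have "\<dots> = 2 powr \<alpha> * exp (\<alpha> * max 0 t)"
    by (simp add: powr_mult) (simp add: powr_def)
  also have "\<dots> \<le> 2 * (1 + exp (\<alpha> * t))"
    by (rule mult_mono[OF two]) (auto simp: max_def)
  finally show ?thesis .
qed

section \<open>The SE map on a fixed strip: inverse, domain and size estimates\<close>

context
  fixes a b d :: real
  assumes ab: "a < b" and d: "0 < d" "d < pi"
begin

lemma psi_SE_ratio:
  assumes "\<zeta> \<in> strip d"
  shows "(psi_SE a b \<zeta> - of_real a) / (of_real b - psi_SE a b \<zeta>) = exp \<zeta>"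
proof -
  note nz = one_plus_exp_nonzero[OF assms d(2)]
  have "of_real (b - a) \<noteq> (0::complex)"
    using ab by (simp del: of_real_diff)
  then have "(psi_SE a b \<zeta> - of_real a) / (of_real b - psi_SE a b \<zeta>) = (1 + exp \<zeta>) / (1 + exp (- \<zeta>))"
    unfolding psi_SE_minus_a[OF nz(2)] b_minus_psi_SE[OF nz] using nz by (simp del: of_real_diff)
  also have "\<dots> = exp \<zeta>"
    using nz by (simp add: exp_minus field_simps)
  finally show ?thesis .
qed

lemma SE_inv_psi_SE: "\<zeta> \<in> strip d \<Longrightarrow> SE_inv a b (psi_SE a b \<zeta>) = \<zeta>"
  using d by (auto simp: SE_inv_def psi_SE_ratio strip_def)

lemma psi_SE_holomorphic: "psi_SE a b holomorphic_on strip d"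
proof (rule holomorphic_transform)
  show "(\<lambda>\<zeta>. of_real (b - a) / (1 + exp (- \<zeta>)) + of_real a) holomorphic_on strip d"
    using one_plus_exp_nonzero(2)[OF _ d(2)] by (intro holomorphic_intros) auto
  show "of_real (b - a) / (1 + exp (- \<zeta>)) + of_real a = psi_SE a b \<zeta>" if "\<zeta> \<in> strip d" for \<zeta>
    using psi_SE_minus_a[OF one_plus_exp_nonzero(2)[OF that d(2)], of a b]
    by (simp add: diff_eq_eq)
qed

lemma open_SE_domain: "open (SE_domain a b d)"
  unfolding SE_domain_def
proof (rule open_mapping_thm3[OF psi_SE_holomorphic open_strip])
  show "inj_on (psi_SE a b) (strip d)"
    by (rule inj_on_inverseI) (rule SE_inv_psi_SE)
qed

lemma SE_domain_cases:
  assumes "z \<in> SE_domain a b d"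
  obtains \<zeta> where "\<zeta> \<in> strip d" "z = psi_SE a b \<zeta>" "SE_inv a b z = \<zeta>"
  using assms SE_inv_psi_SE by (auto simp: SE_domain_def)

lemma endpoints_notin_SE_domain: "of_real a \<notin> SE_domain a b d" "of_real b \<notin> SE_domain a b d"
proof -
  have nz: "of_real (b - a) \<noteq> (0::complex)"
    using ab by (simp del: of_real_diff)
  have "psi_SE a b \<zeta> - of_real a \<noteq> 0" "of_real b - psi_SE a b \<zeta> \<noteq> 0" if "\<zeta> \<in> strip d" for \<zeta>
    unfolding psi_SE_minus_a[OF one_plus_exp_nonzero(2)[OF that d(2)]]
      b_minus_psi_SE[OF one_plus_exp_nonzero[OF that d(2)]]
    using nz one_plus_exp_nonzero[OF that d(2)] by (auto simp del: of_real_diff)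
  then show "of_real a \<notin> SE_domain a b d" "of_real b \<notin> SE_domain a b d"
    by (force simp: SE_domain_def)+
qed

lemma SE_inv_holomorphic: "SE_inv a b holomorphic_on SE_domain a b d"
  unfolding SE_inv_def
proof (intro holomorphic_intros)
  fix z assume z: "z \<in> SE_domain a b d"
  then show "of_real b - z \<noteq> 0"
    using endpoints_notin_SE_domain by auto
  obtain \<zeta> where \<zeta>: "\<zeta> \<in> strip d" "z = psi_SE a b \<zeta>"
    using z by (auto simp: SE_domain_def)
  \<comment> \<open>The branch cut is avoided: a nonpositive real value of
    \<open>exp \<zeta>\<close> would force \<open>Im \<zeta>\<close> to be an odd multiple of
    \<open>pi\<close>.\<close>
  have "exp \<zeta> \<notin> \<real>\<^sub>\<le>\<^sub>0"
  proof
    assume "exp \<zeta> \<in> \<real>\<^sub>\<le>\<^sub>0"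
    then have "sin (Im \<zeta>) = 0" "cos (Im \<zeta>) \<le> 0"
      by (auto simp: complex_nonpos_Reals_iff Re_exp Im_exp mult_le_0_iff)
    moreover have "- pi < Im \<zeta>" "Im \<zeta> < pi"
      using \<zeta>(1) d by (auto simp: strip_def)
    ultimately have "Im \<zeta> = 0" "cos (Im \<zeta>) \<le> 0"
      using sin_eq_0_pi by blast+
    then show False by simp
  qed
  then show "(z - of_real a) / (of_real b - z) \<notin> \<real>\<^sub>\<le>\<^sub>0"
    using psi_SE_ratio[OF \<zeta>(1)] unfolding \<zeta>(2) by simp
qed

text \<open>Up to constants the right side is the derivative of
  \<open>1 / (1 + exp (- \<alpha> * x))\<close> at \<open>x = Re \<zeta>\<close>, so bounds from
  \<open>L_space\<close> pull back to an integrable weight. The factor \<open>4\<close> is the price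
  of moving the power \<open>\<alpha>\<close> into the two exponentials.\<close>

lemma norm_Q_psi_SE_le:
  assumes "\<zeta> \<in> strip d" and \<alpha>: "0 < \<alpha>"
  shows "norm (Q_fun a b (psi_SE a b \<zeta>)) powr \<alpha> \<le>
    4 * ((b - a)^2 / cos (d / 2)^2) powr \<alpha> / ((1 + exp (- \<alpha> * Re \<zeta>)) * (1 + exp (\<alpha> * Re \<zeta>)))"
proof -
  define x \<kappa> where "x = Re \<zeta>" and "\<kappa> = cos (d / 2)"
  have "0 < \<kappa>" using cos_half_pos d by (simp add: \<kappa>_def)
  note nz = one_plus_exp_nonzero[OF assms(1) d(2)]
  have ge: "\<kappa> * (1 + exp (- x)) \<le> norm (1 + exp (- \<zeta>))" "\<kappa> * (1 + exp x) \<le> norm (1 + exp \<zeta>)"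
    using norm_one_plus_exp_ge[of "- \<zeta>" d] norm_one_plus_exp_ge[of \<zeta> d] assms d
    by (auto simp: x_def \<kappa>_def uminus_strip_iff)
  have pos: "0 < 1 + exp t" for t :: real
    by (simp add: add_pos_pos)
  \<comment> \<open>Both \<open>1\<close> and \<open>exp (\<alpha> * t)\<close> are values of
    \<open>powr \<alpha>\<close> at points below \<open>1 + exp t\<close>; adding the two
    inequalities gives the \<open>2\<close>.\<close>
  have powr_ge: "1 + exp (\<alpha> * t) \<le> 2 * (1 + exp t) powr \<alpha>" for t :: real
  proof -
    have "1 powr \<alpha> \<le> (1 + exp t) powr \<alpha>" "exp t powr \<alpha> \<le> (1 + exp t) powr \<alpha>"
      using \<alpha> by (intro powr_mono2; simp)+
    then show ?thesis by (simp add: powr_def)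
  qed
  have "norm (Q_fun a b (psi_SE a b \<zeta>)) = (b - a)^2 / (norm (1 + exp (- \<zeta>)) * norm (1 + exp \<zeta>))"
    unfolding Q_fun_def psi_SE_minus_a[OF nz(2)] b_minus_psi_SE[OF nz]
    using ab by (simp add: norm_mult norm_divide power2_eq_square del: of_real_diff)
  also have "\<dots> \<le> (b - a)^2 / ((\<kappa> * (1 + exp (- x))) * (\<kappa> * (1 + exp x)))"
    using \<open>0 < \<kappa>\<close> by (intro divide_left_mono mult_mono ge mult_pos_pos add_pos_pos)
      (auto simp: nz intro!: add_pos_pos mult_pos_pos)
  also have "\<dots> = ((b - a)^2 / \<kappa>^2) / ((1 + exp (- x)) * (1 + exp x))"
    by (simp add: power2_eq_square mult_ac)
  finally have "norm (Q_fun a b (psi_SE a b \<zeta>)) powr \<alpha>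
      \<le> (((b - a)^2 / \<kappa>^2) / ((1 + exp (- x)) * (1 + exp x))) powr \<alpha>"
    using \<alpha> by (intro powr_mono2) auto
  also have "\<dots> = ((b - a)^2 / \<kappa>^2) powr \<alpha> / ((1 + exp (- x)) powr \<alpha> * (1 + exp x) powr \<alpha>)"
    by (simp add: powr_divide powr_mult)
  also have "\<dots> \<le> ((b - a)^2 / \<kappa>^2) powr \<alpha> / (((1 + exp (\<alpha> * - x)) / 2) * ((1 + exp (\<alpha> * x)) / 2))"
    using powr_ge[of x] powr_ge[of "- x"] pos[of x] pos[of "- x"] pos[of "\<alpha> * x"] pos[of "\<alpha> * - x"]
    by (intro divide_left_mono mult_mono mult_pos_pos) auto
  finally show ?thesis by (simp add: x_def \<kappa>_def mult_ac)
qed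

text \<open>This converts decay on the strip, measured by logistic functions, into the Hoelder
  conditions of \<open>M_space\<close>. Both parts are instances of \<open>gen\<close>, at
  \<open>- \<zeta>\<close> and at \<open>\<zeta>\<close>.\<close>

lemma logistic_le_norm_psi_SE:
  assumes \<zeta>: "\<zeta> \<in> strip d" and \<alpha>: "0 < \<alpha>" "\<alpha> \<le> 1"
  shows "1 / (1 + exp (- \<alpha> * Re \<zeta>)) \<le> 2 / (b - a) powr \<alpha> * norm (psi_SE a b \<zeta> - of_real a) powr \<alpha>"
    and "1 / (1 + exp (\<alpha> * Re \<zeta>)) \<le> 2 / (b - a) powr \<alpha> * norm (of_real b - psi_SE a b \<zeta>) powr \<alpha>"
proof -
  have gen: "1 / (1 + exp (\<alpha> * Re \<xi>)) \<le> 2 / (b - a) powr \<alpha> * norm (of_real (b - a) / (1 + exp \<xi>)) powr \<alpha>"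
    if "1 + exp \<xi> \<noteq> 0" for \<xi>
  proof -
    have "norm (1 + exp \<xi>) powr \<alpha> \<le> (1 + exp (Re \<xi>)) powr \<alpha>"
      using \<alpha> norm_one_plus_exp_le by (intro powr_mono2) auto
    also note one_plus_exp_powr_le[OF \<alpha>, of "Re \<xi>"]
    finally have "1 / (2 * (1 + exp (\<alpha> * Re \<xi>))) \<le> 1 / norm (1 + exp \<xi>) powr \<alpha>"
      using that by (intro divide_left_mono) (auto intro!: mult_pos_pos add_pos_pos)
    moreover have "norm (of_real (b - a) / (1 + exp \<xi>)) powr \<alpha> = (b - a) powr \<alpha> / norm (1 + exp \<xi>) powr \<alpha>"
      using ab by (simp add: norm_divide powr_divide del: of_real_diff)
    moreover have "0 < (b - a) powr \<alpha>" using ab by simp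
    moreover define q where "q = 1 + exp (\<alpha> * Re \<xi>)"
    ultimately show ?thesis unfolding q_def[symmetric] by (simp add: field_simps del: of_real_diff)
  qed
  note nz = one_plus_exp_nonzero[OF \<zeta> d(2)]
  show "1 / (1 + exp (- \<alpha> * Re \<zeta>)) \<le> 2 / (b - a) powr \<alpha> * norm (psi_SE a b \<zeta> - of_real a) powr \<alpha>"
    using gen[OF nz(2)] by (simp add: psi_SE_minus_a[OF nz(2)] del: of_real_diff)
  show "1 / (1 + exp (\<alpha> * Re \<zeta>)) \<le> 2 / (b - a) powr \<alpha> * norm (of_real b - psi_SE a b \<zeta>) powr \<alpha>"
    using gen[OF nz(1)] by (simp add: b_minus_psi_SE[OF nz] del: of_real_diff)
qed

end

section \<open>Logistic functions as majorants\<close>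

lemma logistic_deriv:
  fixes \<alpha> c x :: real
  shows "((\<lambda>x. c / (1 + exp (- \<alpha> * x))) has_real_derivative
           c * \<alpha> / ((1 + exp (- \<alpha> * x)) * (1 + exp (\<alpha> * x)))) (at x)"
proof -
  have nz: "1 + exp t \<noteq> 0" for t :: real
    using exp_gt_zero[of t] by linarith
  have "((\<lambda>x. c / (1 + exp (- \<alpha> * x))) has_real_derivative
      c * \<alpha> * exp (- \<alpha> * x) / (1 + exp (- \<alpha> * x))^2) (at x)"
    by (rule derivative_eq_intros refl nz)+ (simp add: nz power2_eq_square)
  also have "c * \<alpha> * exp (- \<alpha> * x) / (1 + exp (- \<alpha> * x))^2
      = c * \<alpha> / ((1 + exp (- \<alpha> * x)) * (1 + exp (\<alpha> * x)))"
    using nz by (simp add: exp_minus power2_eq_square divide_simps)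
  finally show ?thesis .
qed

lemma logistic_majorant:
  assumes "0 < \<alpha>" "0 \<le> c"
  shows "majorant (\<lambda>x. c / (1 + exp (- \<alpha> * x)))
           (\<lambda>x. c * \<alpha> / ((1 + exp (- \<alpha> * x)) * (1 + exp (\<alpha> * x)))) c"
proof
  fix x :: real
  show "((\<lambda>x. c / (1 + exp (- \<alpha> * x))) has_real_derivative
      c * \<alpha> / ((1 + exp (- \<alpha> * x)) * (1 + exp (\<alpha> * x)))) (at x)"
    by (rule logistic_deriv)
  show "c / (1 + exp (- \<alpha> * x)) \<le> c"
    using \<open>0 \<le> c\<close> by (simp add: divide_le_eq mult_left_le add_pos_pos algebra_simps)
  show "0 \<le> c / (1 + exp (- \<alpha> * x))" "0 \<le> c * \<alpha> / ((1 + exp (- \<alpha> * x)) * (1 + exp (\<alpha> * x)))"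
    using assms by (auto intro!: divide_nonneg_nonneg mult_nonneg_nonneg add_nonneg_nonneg)
qed (use \<open>0 < \<alpha>\<close> in real_asymp)+

section \<open>The substitution on the real axis\<close>

definition SE_inv_real :: "real \<Rightarrow> real \<Rightarrow> real \<Rightarrow> real" where
  "SE_inv_real a b t = ln ((t - a) / (b - t))"

definition psi_SE_real :: "real \<Rightarrow> real \<Rightarrow> real \<Rightarrow> real" where
  "psi_SE_real a b x = a + (b - a) / (1 + exp (- x))"

lemma real_in_strip: "0 < d \<Longrightarrow> of_real x \<in> strip d"
  by (simp add: strip_def)

lemma SE_inv_of_real:
  assumes "t \<in> {a<..<b}"
  shows "SE_inv a b (of_real t) = of_real (SE_inv_real a b t)"
proof -
  have "SE_inv a b (of_real t) = Ln (of_real ((t - a) / (b - t)))"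
    by (simp add: SE_inv_def)
  then show ?thesis
    using assms by (simp add: SE_inv_real_def Ln_of_real del: of_real_divide)
qed

lemma psi_SE_of_real: "psi_SE a b (of_real x) = of_real (psi_SE_real a b x)"
proof -
  have "1 + exp (- of_real x) \<noteq> (0 :: complex)"
    using one_plus_exp_nonzero(2)[OF real_in_strip[of "pi / 2" x]] by simp
  then have "psi_SE a b (of_real x) - of_real a = of_real (b - a) / (1 + exp (- of_real x))"
    by (rule psi_SE_minus_a)
  also have "\<dots> = of_real ((b - a) / (1 + exp (- x)))"
    by (simp add: exp_of_real flip: of_real_minus)
  finally show ?thesis
    by (simp add: psi_SE_real_def diff_eq_eq add.commute)
qed

lemma psi_SE_real_bounds:
  assumes ab: "a < b"
  shows "psi_SE_real a b x \<in> {a<..<b}"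
proof -
  have pos: "0 < 1 + exp (- x)" by (simp add: add_pos_pos)
  have "(b - a) * 1 < (b - a) * (1 + exp (- x))"
    using ab by (intro mult_strict_left_mono) auto
  then have "(b - a) / (1 + exp (- x)) < b - a"
    by (simp only: pos_divide_less_eq[OF pos] mult_1_right)
  moreover have "0 < (b - a) / (1 + exp (- x))"
    using ab pos by simp
  ultimately show ?thesis by (auto simp: psi_SE_real_def)
qed

lemma psi_SE_real_SE_inv_real:
  assumes ab: "a < b" and "t \<in> {a<..<b}"
  shows "psi_SE_real a b (SE_inv_real a b t) = t"
proof -
  have "psi_SE a b (of_real (SE_inv_real a b t)) = of_real t"
    using psi_SE_SE_inv[OF ab, of "of_real t"] assms by (simp flip: SE_inv_of_real)
  then show ?thesis by (simp add: psi_SE_of_real)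
qed

text \<open>The derivative is \<open>Q_fun\<close> at the image point divided by
  \<open>b - a\<close>; this factor absorbs the singularities that the coefficients may have at the
  endpoints.\<close>

lemma psi_SE_real_deriv:
  assumes ab: "a < b"
  shows "(psi_SE_real a b has_real_derivative (psi_SE_real a b x - a) * (b - psi_SE_real a b x) / (b - a)) (at x)"
proof -
  have pos: "0 < 1 + exp (- x)" by (simp add: add_pos_pos)
  have "((\<lambda>x. a + (b - a) / (1 + exp (- x))) has_real_derivative
      (b - a) * exp (- x) / (1 + exp (- x))^2) (at x)"
    by (rule derivative_eq_intros refl)+ (use pos in \<open>simp_all add: power2_eq_square\<close>)
  also have "(b - a) * exp (- x) / (1 + exp (- x))^2
      = (psi_SE_real a b x - a) * (b - psi_SE_real a b x) / (b - a)"
  proof -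
    have "b - psi_SE_real a b x = (b - a) * exp (- x) / (1 + exp (- x))"
      using pos by (simp add: psi_SE_real_def field_simps)
    then show ?thesis
      using ab by (simp add: psi_SE_real_def power2_eq_square)
  qed
  finally show ?thesis by (simp add: psi_SE_real_def[abs_def])
qed

lemma psi_SE_real_at_bot: "(psi_SE_real a b \<longlongrightarrow> a) at_bot"
proof -
  have "((\<lambda>x::real. 1 / (1 + exp (- x))) \<longlongrightarrow> 0) at_bot"
    by real_asymp
  then have "((\<lambda>x. a + (b - a) * (1 / (1 + exp (- x)))) \<longlongrightarrow> a + (b - a) * 0) at_bot"
    by (intro tendsto_intros)
  then show ?thesis by (simp add: psi_SE_real_def[abs_def])
qed

lemma SE_inv_real_deriv:
  assumes "t \<in> {a<..<b}"
  shows "(SE_inv_real a b has_real_derivative (b - a) / ((t - a) * (b - t))) (at t)"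
proof -
  have "((\<lambda>t. (t - a) / (b - t)) has_real_derivative (b - a) / (b - t)^2) (at t)"
    by (rule derivative_eq_intros refl)+ (use assms in \<open>auto simp: power2_eq_square\<close>)
  then have "((\<lambda>t. ln ((t - a) / (b - t))) has_real_derivative
      1 / ((t - a) / (b - t)) * ((b - a) / (b - t)^2)) (at t)"
    using assms by (intro DERIV_chain2[OF DERIV_ln_divide]) auto
  then show ?thesis
    using assms by (simp add: SE_inv_real_def[abs_def] power2_eq_square)
qed

text \<open>In the variable \<open>t\<close> the logistic function takes a form that extends
  continuously to \<open>a\<close> and \<open>b\<close>, although the logarithm diverges
  there.\<close>

lemma logistic_SE_inv_real:
  assumes "t \<in> {a<..<b}"
  shows "1 / (1 + exp (- \<alpha> * SE_inv_real a b t)) = (t - a) powr \<alpha> / ((t - a) powr \<alpha> + (b - t) powr \<alpha>)"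
proof -
  have "exp (- \<alpha> * SE_inv_real a b t) = ((t - a) / (b - t)) powr (- \<alpha>)"
    using assms by (simp add: SE_inv_real_def powr_def)
  also have "\<dots> = (b - t) powr \<alpha> / (t - a) powr \<alpha>"
    using assms by (simp add: powr_divide powr_minus field_simps)
  finally have exp: "exp (- \<alpha> * SE_inv_real a b t) = (b - t) powr \<alpha> / (t - a) powr \<alpha>" .
  have "0 < (t - a) powr \<alpha>" "0 < (b - t) powr \<alpha>"
    using assms by auto
  then show ?thesis
    unfolding exp by (simp add: field_simps)
qed

text \<open>The integrand may be unbounded near the endpoints, but on the open interval it is the
  derivative of \<open>\<Sigma>\<close>, which is continuous on the closed one; the fundamental
  theorem gives integrability. It will dominate the right-hand side of the equation.\<close>

lemma logistic_derivative_integrable: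
  assumes ab: "a < b" and "0 < \<alpha>"
  shows "(\<lambda>t. c * \<alpha> / ((1 + exp (- \<alpha> * SE_inv_real a b t)) * (1 + exp (\<alpha> * SE_inv_real a b t))) *
           ((b - a) / ((t - a) * (b - t)))) integrable_on {a..b}"
proof -
  define \<Sigma> where "\<Sigma> = (\<lambda>t. c * ((t - a) powr \<alpha> / ((t - a) powr \<alpha> + (b - t) powr \<alpha>)))"
  have "(t - a) powr \<alpha> + (b - t) powr \<alpha> \<noteq> 0" if "t \<in> {a..b}" for t
    using ab that by (auto simp: add_nonneg_eq_0_iff)
  then have "continuous_on {a..b} \<Sigma>"
    unfolding \<Sigma>_def using \<open>0 < \<alpha>\<close>
    by (intro continuous_intros continuous_on_powr') auto
  moreover have "(\<Sigma> has_vector_derivative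
      c * \<alpha> / ((1 + exp (- \<alpha> * SE_inv_real a b t)) * (1 + exp (\<alpha> * SE_inv_real a b t))) *
      ((b - a) / ((t - a) * (b - t)))) (at t)" if t: "t \<in> {a<..<b}" for t
  proof (rule has_vector_derivative_transform_within_open)
    have "0 \<le> \<bar>c\<bar>" by simp
    show "((\<lambda>t. c / (1 + exp (- \<alpha> * SE_inv_real a b t))) has_vector_derivative
        c * \<alpha> / ((1 + exp (- \<alpha> * SE_inv_real a b t)) * (1 + exp (\<alpha> * SE_inv_real a b t))) *
        ((b - a) / ((t - a) * (b - t)))) (at t)"
      unfolding has_real_derivative_iff_has_vector_derivative[symmetric]
      by (rule DERIV_chain2[OF logistic_deriv SE_inv_real_deriv[OF t]])
    show "c / (1 + exp (- \<alpha> * SE_inv_real a b s)) = \<Sigma> s" if "s \<in> {a<..<b}" for s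
      using logistic_SE_inv_real[OF that, of \<alpha>] by (simp add: \<Sigma>_def divide_inverse)
  qed (use t in auto)
  ultimately show ?thesis
    using ab by (intro has_integral_integrable[OF fundamental_theorem_of_calculus_interior[of a b \<Sigma>]]) auto
qed

section \<open>Transfer of the function spaces between the strip and its image\<close>

context
  fixes a b d :: real
  assumes ab: "a < b" and d: "0 < d" "d < pi"
begin

lemma of_real_in_SE_domain:
  assumes "t \<in> {a<..<b}"
  shows "of_real t \<in> SE_domain a b d"
  using psi_SE_of_real psi_SE_real_SE_inv_real[OF ab assms] real_in_strip[OF d(1)]
  unfolding SE_domain_def by (metis image_eqI)

lemma L_space_pullback:
  assumes f: "f \<in> L_space a b \<alpha> (SE_domain a b d)" and "0 < \<alpha>"
  shows "(\<lambda>\<zeta>. f (psi_SE a b \<zeta>)) holomorphic_on strip d"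
    and "\<exists>C\<ge>0. \<forall>\<zeta>\<in>strip d. norm (f (psi_SE a b \<zeta>))
           \<le> C / ((1 + exp (- \<alpha> * Re \<zeta>)) * (1 + exp (\<alpha> * Re \<zeta>)))"
proof -
  have "f holomorphic_on SE_domain a b d"
    using f by (auto simp: L_space_def H_inf_def analytic_imp_holomorphic)
  from holomorphic_on_compose_gen[OF psi_SE_holomorphic[OF ab d] this]
  show "(\<lambda>\<zeta>. f (psi_SE a b \<zeta>)) holomorphic_on strip d"
    by (simp add: o_def SE_domain_def)
  obtain L where L: "\<And>z. z \<in> SE_domain a b d \<Longrightarrow> norm (f z) \<le> L * norm (Q_fun a b z) powr \<alpha>"
    using f by (auto simp: L_space_def)
  \<comment> \<open>The constant of \<open>norm_Q_psi_SE_le\<close>. It is combined with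
    \<open>\<bar>L\<bar>\<close> because \<open>L_space\<close> does not fix the sign of
    \<open>L\<close>.\<close>
  define B where "B = 4 * ((b - a)^2 / cos (d / 2)^2) powr \<alpha>"
  show "\<exists>C\<ge>0. \<forall>\<zeta>\<in>strip d. norm (f (psi_SE a b \<zeta>))
           \<le> C / ((1 + exp (- \<alpha> * Re \<zeta>)) * (1 + exp (\<alpha> * Re \<zeta>)))"
  proof (intro exI[of _ "\<bar>L\<bar> * B"] conjI ballI)
    fix \<zeta> assume \<zeta>: "\<zeta> \<in> strip d"
    have "norm (f (psi_SE a b \<zeta>)) \<le> L * norm (Q_fun a b (psi_SE a b \<zeta>)) powr \<alpha>"
      using \<zeta> by (intro L) (auto simp: SE_domain_def)
    also have "\<dots> \<le> \<bar>L\<bar> * (B / ((1 + exp (- \<alpha> * Re \<zeta>)) * (1 + exp (\<alpha> * Re \<zeta>))))"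
      using norm_Q_psi_SE_le[OF ab d \<zeta> \<open>0 < \<alpha>\<close>] by (intro mult_mono) (auto simp: B_def)
    finally show "norm (f (psi_SE a b \<zeta>)) \<le> \<bar>L\<bar> * B / ((1 + exp (- \<alpha> * Re \<zeta>)) * (1 + exp (\<alpha> * Re \<zeta>)))"
      by simp
  qed (simp add: B_def)
qed

text \<open>The limits \<open>r\<close> and \<open>U\<close> of \<open>u\<close> at the two ends of
  the strip become the boundary values; they are assigned explicitly because \<open>M_space\<close>
  refers to the values of the total function at \<open>a\<close> and \<open>b\<close>.\<close>

lemma M_space_pushforward:
  assumes \<alpha>: "0 < \<alpha>" "\<alpha> \<le> 1" and u: "u holomorphic_on strip d"
    and u_a: "\<And>\<zeta>. \<zeta> \<in> strip d \<Longrightarrow> norm (u \<zeta> - r) \<le> C / (1 + exp (- \<alpha> * Re \<zeta>))"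
    and u_b: "\<And>\<zeta>. \<zeta> \<in> strip d \<Longrightarrow> norm (U - u \<zeta>) \<le> C / (1 + exp (\<alpha> * Re \<zeta>))"
    and "0 \<le> C"
  shows "(\<lambda>z. if z = of_real a then r else if z = of_real b then U else u (SE_inv a b z))
           \<in> M_space a b \<alpha> (SE_domain a b d)" (is "?f \<in> _")
proof -
  let ?D = "SE_domain a b d"
  note ends = endpoints_notin_SE_domain[OF ab d]
  have f_eq: "?f z = u (SE_inv a b z)" if "z \<in> ?D" for z
    using that ends by auto
  have inv: "SE_inv a b z \<in> strip d" if "z \<in> ?D" for z
    using that by (auto elim: SE_domain_cases[OF ab d])
  have "(\<lambda>z. u (SE_inv a b z)) holomorphic_on ?D"
    using holomorphic_on_compose_gen[OF SE_inv_holomorphic[OF ab d] u] inv by (auto simp: o_def)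
  then have "?f holomorphic_on ?D"
    by (rule holomorphic_transform) (simp add: f_eq)
  then have "?f analytic_on ?D"
    by (simp add: analytic_on_open open_SE_domain[OF ab d])
  moreover have "bounded (?f ` ?D)"
  proof (rule boundedI)
    fix w assume "w \<in> ?f ` ?D"
    then obtain z where z: "z \<in> ?D" "w = u (SE_inv a b z)"
      using f_eq by auto
    have "norm (w - r) \<le> C / (1 + exp (- \<alpha> * Re (SE_inv a b z)))"
      using u_a[OF inv[OF z(1)]] z by simp
    also have "\<dots> \<le> C"
      using \<open>0 \<le> C\<close> by (simp add: divide_le_eq mult_left_le add_pos_pos algebra_simps)
    finally show "norm w \<le> norm r + C"
      using norm_triangle_sub[of w r] by linarith
  qed
  moreover define M where "M = C * (2 / (b - a) powr \<alpha>)"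
  have bound_a: "norm (?f z - ?f (of_real a)) \<le> M * norm (z - of_real a) powr \<alpha>"
    and bound_b: "norm (?f (of_real b) - ?f z) \<le> M * norm (of_real b - z) powr \<alpha>" if z: "z \<in> ?D" for z
  proof -
    obtain \<zeta> where \<zeta>: "\<zeta> \<in> strip d" "z = psi_SE a b \<zeta>" "SE_inv a b z = \<zeta>"
      using SE_domain_cases[OF ab d z] by blast
    have "norm (?f z - ?f (of_real a)) \<le> C * (1 / (1 + exp (- \<alpha> * Re \<zeta>)))"
      using u_a[OF \<zeta>(1)] f_eq[OF z] \<zeta>(3) by simp
    also have "\<dots> \<le> C * (2 / (b - a) powr \<alpha> * norm (z - of_real a) powr \<alpha>)"
      unfolding \<zeta>(2) by (intro mult_left_mono logistic_le_norm_psi_SE[OF ab d \<zeta>(1) \<alpha>] \<open>0 \<le> C\<close>)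
    finally show "norm (?f z - ?f (of_real a)) \<le> M * norm (z - of_real a) powr \<alpha>"
      by (simp add: M_def)
    have "norm (?f (of_real b) - ?f z) \<le> C * (1 / (1 + exp (\<alpha> * Re \<zeta>)))"
      using u_b[OF \<zeta>(1)] f_eq[OF z] \<zeta>(3) ab by simp
    also have "\<dots> \<le> C * (2 / (b - a) powr \<alpha> * norm (of_real b - z) powr \<alpha>)"
      unfolding \<zeta>(2) by (intro mult_left_mono logistic_le_norm_psi_SE[OF ab d \<zeta>(1) \<alpha>] \<open>0 \<le> C\<close>)
    finally show "norm (?f (of_real b) - ?f z) \<le> M * norm (of_real b - z) powr \<alpha>"
      by (simp add: M_def)
  qed
  \<comment> \<open>The Hoelder bound itself yields the boundary limit, as
    \<open>0 < \<alpha>\<close> makes its right side tend to \<open>0\<close>.\<close>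
  have lim: "(?f \<longlongrightarrow> ?f p) (at p within ?D)"
    if "\<And>z. z \<in> ?D \<Longrightarrow> norm (?f z - ?f p) \<le> M * norm (z - p) powr \<alpha>" for p
  proof -
    have "((\<lambda>z. M * norm (z - p) powr \<alpha>) \<longlongrightarrow> M * norm (p - p) powr \<alpha>) (at p within ?D)"
      using \<alpha>(1) by (intro tendsto_intros tendsto_powr') auto
    then have "((\<lambda>z. M * norm (z - p) powr \<alpha>) \<longlongrightarrow> 0) (at p within ?D)"
      by simp
    then have "((\<lambda>z. ?f z - ?f p) \<longlongrightarrow> 0) (at p within ?D)"
      by (rule Lim_null_comparison[rotated]) (use that in \<open>auto simp: eventually_at_filter\<close>)
    then show ?thesis by (rule Lim_null[THEN iffD2])
  qed
  have "(?f \<longlongrightarrow> ?f (of_real a)) (at (of_real a) within ?D)"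
    using bound_a by (intro lim)
  moreover have "(?f \<longlongrightarrow> ?f (of_real b)) (at (of_real b) within ?D)"
    using bound_b by (intro lim) (metis norm_minus_commute)
  ultimately show ?thesis
    using bound_a bound_b unfolding M_space_def H_inf_def by blast
qed

text \<open>At the endpoints the limit within the domain is restricted to the open real interval,
  which the domain contains; inside, analyticity gives continuity.\<close>

lemma M_space_continuous_on:
  assumes f: "f \<in> M_space a b \<alpha> (SE_domain a b d)"
  shows "continuous_on {a..b} (\<lambda>t. f (of_real t))"
proof (rule continuous_on_IccI)
  let ?D = "SE_domain a b d"
  have lim: "((\<lambda>t. f (of_real t)) \<longlongrightarrow> f (of_real c)) (at c within T)"
    if "\<forall>\<^sub>F t in at c within T. t \<in> {a<..<b}" "(f \<longlongrightarrow> f (of_real c)) (at (of_real c) within ?D)" for c T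
  proof (rule filterlim_compose[OF that(2)], unfold filterlim_at, intro conjI)
    show "\<forall>\<^sub>F t in at c within T. of_real t \<in> ?D \<and> of_real t \<noteq> (of_real c :: complex)"
      using that(1) eventually_neq_at_within[of c c T]
      by eventually_elim (use of_real_in_SE_domain in auto)
  qed (intro tendsto_of_real tendsto_ident_at)
  show "((\<lambda>t. f (of_real t)) \<longlongrightarrow> f (of_real a)) (at_right a)"
    "((\<lambda>t. f (of_real t)) \<longlongrightarrow> f (of_real b)) (at_left b)"
    using f eventually_at_right_real[OF ab] eventually_at_left_real[OF ab]
    by (auto simp: M_space_def intro!: lim)
  have "continuous_on ?D f"
    using f by (auto simp: M_space_def H_inf_def analytic_imp_holomorphic holomorphic_on_imp_continuous_on)
  then show "(\<lambda>t. f (of_real t)) \<midarrow>t\<rightarrow> f (of_real t)" if "a < t" "t < b" for t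
    using of_real_in_SE_domain[of t] that open_SE_domain[OF ab d]
    by (auto simp: continuous_on_eq_continuous_at intro!: isCont_tendsto_compose[of _ f] tendsto_of_real)
qed (rule ab)

end

text \<open>The fundamental theorem with derivatives only in the interior makes \<open>F\<close>
  integrable despite singular endpoints; domination by \<open>B\<close> upgrades this to absolute
  integrability.\<close>

lemma solves_integral_equation:
  fixes y :: "real \<Rightarrow> 'a::euclidean_space"
  assumes cont: "continuous_on {a..b} y"
    and deriv: "\<And>t. t \<in> {a<..<b} \<Longrightarrow> (y has_vector_derivative F t) (at t)"
    and bound: "\<And>t. t \<in> {a<..<b} \<Longrightarrow> norm (F t) \<le> B t" and B: "B integrable_on {a..b}"
  shows "F absolutely_integrable_on {a..b}"
    and "t \<in> {a..b} \<Longrightarrow> y t = y a + integral {a..t} F"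
proof -
  have int: "(F has_integral y t - y a) {a..t}" if "t \<in> {a..b}" for t
    using that deriv by (intro fundamental_theorem_of_calculus_interior continuous_on_subset[OF cont]) auto
  show "y t = y a + integral {a..t} F" if "t \<in> {a..b}"
    using integral_unique[OF int[OF that]] by simp
  show "F absolutely_integrable_on {a..b}"
  proof (cases "a \<le> b")
    case True
    then have "F integrable_on {a<..<b}"
      using int[of b] by (auto simp: has_integral_integrable integrable_on_Icc_iff_Ioo[symmetric])
    moreover have "B integrable_on {a<..<b}"
      using B by (simp add: integrable_on_Icc_iff_Ioo)
    ultimately have "F absolutely_integrable_on {a<..<b}"
      using bound by (intro absolutely_integrable_integrable_bound)
    then show ?thesis
      by (simp add: absolutely_integrable_on_Icc_iff_Ioo)
  qed simp
qed

subsection \<open>Existence and uniqueness\<close>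

lemma has_vector_derivative_vec:
  fixes f :: "real \<Rightarrow> 'a::real_normed_vector ^ 'n::finite"
  assumes "\<And>i. ((\<lambda>t. f t $ i) has_vector_derivative f' $ i) (at x within S)"
  shows "(f has_vector_derivative f') (at x within S)"
  using assms unfolding has_vector_derivative_def has_derivative_within
  by (auto intro!: vec_tendstoI bounded_linear_scaleR_left)

lemma norm_le_sum_components:
  fixes x :: "'a::real_normed_vector ^ 'n::finite"
  shows "norm x \<le> (\<Sum>i\<in>UNIV. norm (x $ i))"
  unfolding norm_vec_def by (rule L2_set_le_sum) simp

text \<open>The difference \<open>e\<close> of two solutions satisfies the homogeneous integral
  equation; composed with \<open>psi_SE_real\<close> it solves a homogeneous system on the real line
  and vanishes at minus infinity, so \<open>homogeneous_system_zero\<close> applies.\<close>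

lemma ivp_unique:
  fixes K :: "complex \<Rightarrow> complex ^ 'n ^ 'n::finite"
  assumes ab: "a < b" and maj: "majorant \<sigma> \<sigma>' S"
    and K_cont: "\<And>i j t. t \<in> {a<..<b} \<Longrightarrow> isCont (\<lambda>s. K (of_real s) $ i $ j) t"
    and K_le: "\<And>i j x. norm (K (of_real (psi_SE_real a b x)) $ i $ j) *
        ((psi_SE_real a b x - a) * (b - psi_SE_real a b x) / (b - a)) \<le> \<sigma>' x"
    and w: "solves_ivp a b K g r w" and v: "solves_ivp a b K g r v"
    and t: "t \<in> {a..b}"
  shows "w t = v t"
proof -
  interpret majorant \<sigma> \<sigma>' S by (rule maj)
  define p where "p = psi_SE_real a b"
  define e where "e = (\<lambda>t. w t - v t)"
  define p' where "p' = (\<lambda>x. (p x - a) * (b - p x) / (b - a))"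
  have p_bounds: "p x \<in> {a<..<b}" for x
    unfolding p_def by (rule psi_SE_real_bounds[OF ab])
  have p'_nonneg: "0 \<le> p' x" for x
    using p_bounds[of x] ab unfolding p'_def
    by (intro divide_nonneg_nonneg mult_nonneg_nonneg) auto
  have p_deriv: "(p has_real_derivative p' x) (at x)" for x
    unfolding p_def p'_def by (rule psi_SE_real_deriv[OF ab])
  have e_cont: "continuous_on {a..b} e"
    using w v unfolding e_def solves_ivp_def by (intro continuous_intros) auto
  have ints: "(\<lambda>s. g (of_real s) + K (of_real s) *v w s) integrable_on {a..s}"
    "(\<lambda>s. g (of_real s) + K (of_real s) *v v s) integrable_on {a..s}" if "s \<in> {a..b}" for s
    using w v that unfolding solves_ivp_def
    by (auto intro: integrable_subinterval_real set_lebesgue_integral_eq_integral(1))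
  have diff_eq: "(g (of_real s) + K (of_real s) *v w s) - (g (of_real s) + K (of_real s) *v v s)
      = K (of_real s) *v e s" for s
    by (simp add: e_def matrix_vector_mult_diff_distrib)
  have e_eq: "e s = integral {a..s} (\<lambda>s. K (of_real s) *v e s)" if "s \<in> {a..b}" for s
  proof -
    have "e s = integral {a..s} (\<lambda>s. g (of_real s) + K (of_real s) *v w s)
        - integral {a..s} (\<lambda>s. g (of_real s) + K (of_real s) *v v s)"
      using w v that by (simp add: e_def solves_ivp_def)
    also have "\<dots> = integral {a..s} (\<lambda>s. K (of_real s) *v e s)"
      unfolding diff_eq[symmetric] by (rule integral_diff[symmetric]) (rule ints[OF that])+
    finally show ?thesis .
  qed
  have int_e: "(\<lambda>s. K (of_real s) *v e s) integrable_on {a..b}"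
    unfolding diff_eq[symmetric] by (rule integrable_diff) (rule ints, use ab in simp)+
  \<comment> \<open>Differentiating the integral at \<open>s\<close> requires continuity of the
    integrand there, which is where \<open>K_cont\<close> enters.\<close>
  have e_deriv: "(e has_vector_derivative K (of_real s) *v e s) (at s)" if s: "s \<in> {a<..<b}" for s
  proof -
    have e_s: "isCont e s"
      using s by (intro continuous_on_interior[OF e_cont]) simp
    have "isCont (\<lambda>s. K (of_real s) *v e s) s"
      unfolding matrix_vector_mult_def isCont_def
      by (intro tendsto_vec_lambda tendsto_sum tendsto_mult
          K_cont[OF s, unfolded isCont_def] tendsto_vec_nth[OF e_s[unfolded isCont_def]])
    then have "((\<lambda>u. integral {a..u} (\<lambda>s. K (of_real s) *v e s)) has_vector_derivative
        K (of_real s) *v e s) (at s within {a..b} - {})"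
      using s by (intro integral_has_vector_derivative_continuous_at int_e)
        (auto intro: continuous_at_imp_continuous_within)
    then have "(e has_vector_derivative K (of_real s) *v e s) (at s within {a..b})"
      using s e_eq by (auto intro: has_vector_derivative_transform)
    then show ?thesis
      using s by (simp add: at_within_Icc_at)
  qed
  \<comment> \<open>The chain rule multiplies \<open>K\<close> by \<open>p'\<close>, producing the
    coefficients that \<open>K_le\<close> bounds by \<open>\<sigma>'\<close>.\<close>
  have E_deriv: "((\<lambda>x. e (p x) $ i) has_vector_derivative
      (\<Sum>j\<in>UNIV. (K (of_real (p x)) $ i $ j * of_real (p' x)) * e (p x) $ j)) (at x)" for i x
  proof -
    have "(p has_vector_derivative p' x) (at x)"
      using p_deriv by (simp add: has_real_derivative_iff_has_vector_derivative)
    from vector_diff_chain_at[OF this e_deriv[OF p_bounds]]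
    have "((\<lambda>x. e (p x)) has_vector_derivative p' x *\<^sub>R (K (of_real (p x)) *v e (p x))) (at x)"
      by (simp add: o_def)
    moreover have "(p' x *\<^sub>R (K (of_real (p x)) *v e (p x))) $ i
        = (\<Sum>j\<in>UNIV. (K (of_real (p x)) $ i $ j * of_real (p' x)) * e (p x) $ j)"
      unfolding vector_scaleR_component matrix_vector_mult_def vec_lambda_beta scaleR_sum_right
      by (intro sum.cong refl) (simp only: scaleR_conv_of_real mult_ac)
    ultimately show ?thesis
      using bounded_linear.has_vector_derivative[OF bounded_linear_vec_nth, of "\<lambda>x. e (p x)" _ _ i]
      by fastforce
  qed
  have "((\<lambda>x. e (p x)) \<longlongrightarrow> e a) at_bot"
    using psi_SE_real_at_bot[of a b] p_bounds ab unfolding p_def[symmetric]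
    by (intro continuous_on_tendsto_compose[OF e_cont]) (auto simp: less_imp_le)
  moreover have "e a = 0"
    using e_eq[of a] ab by simp
  ultimately have E_lim: "((\<lambda>x. e (p x) $ i) \<longlongrightarrow> 0) at_bot" for i
    using tendsto_vec_nth[of "\<lambda>x. e (p x)" 0 at_bot i] by simp
  have "bounded (e ` {a..b})"
    by (intro compact_imp_bounded compact_continuous_image e_cont) auto
  then obtain B where B: "\<And>s. s \<in> {a..b} \<Longrightarrow> norm (e s) \<le> B"
    unfolding bounded_iff by blast
  have E_zero: "e (p x) $ i = 0" for x i
  proof (rule homogeneous_system_zero[OF E_deriv _ E_lim])
    show "norm (K (of_real (p x)) $ i $ j * of_real (p' x)) \<le> \<sigma>' x" for i j x
    proof -
      have "norm (K (of_real (p x)) $ i $ j) * p' x \<le> \<sigma>' x"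
        using K_le[of x i j] by (simp only: p_def p'_def)
      then show ?thesis using p'_nonneg[of x] by (simp add: norm_mult)
    qed
    show "norm (e (p x) $ i) \<le> B" for i x
      using p_bounds[of x] by (intro order.trans[OF Finite_Cartesian_Product.norm_nth_le B]) auto
  qed
  have e_zero: "e s = 0" if "s \<in> {a<..<b}" for s
  proof -
    have "p (SE_inv_real a b s) = s"
      unfolding p_def by (rule psi_SE_real_SE_inv_real[OF ab that])
    then show ?thesis using E_zero[of "SE_inv_real a b s"] by (simp add: vec_eq_iff)
  qed
  \<comment> \<open>The substitution reaches only the open interval; continuity of \<open>e\<close>
    carries the result to the endpoints.\<close>
  have closure_eq: "closure {a<..<b} = {a..b}"
    using ab by simp
  have "e t = 0"
    by (rule continuous_constant_on_closure[of "{a<..<b}" e 0 t, OF _ e_zero])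
      (use t e_cont in \<open>simp_all add: closure_eq\<close>)
  then show ?thesis by (simp add: e_def)
qed

theorem theorem6:
  fixes a b d \<alpha> :: real
    and r :: "complex ^ 'n::finite"
    and K :: "complex \<Rightarrow> complex ^ 'n ^ 'n"
    and g :: "complex \<Rightarrow> complex ^ 'n"
  assumes "a < b" and "0 < d" and "d < pi" and "0 < \<alpha>" and "\<alpha> \<le> 1"
    and "\<And>i j. (\<lambda>z. K z $ i $ j * Q_fun a b z) \<in> L_space a b \<alpha> (SE_domain a b d)"
    and "\<And>i. (\<lambda>z. g z $ i * Q_fun a b z) \<in> L_space a b \<alpha> (SE_domain a b d)"
  shows "\<exists>y. solves_ivp a b K g r y \<and>
           (\<forall>w. solves_ivp a b K g r w \<longrightarrow> (\<forall>t\<in>{a..b}. w t = y t)) \<and>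
           (\<forall>i. extends_to_M_space a b \<alpha> (SE_domain a b d) (\<lambda>t. y t $ i))"
proof -
  note ab = \<open>a < b\<close> and d = \<open>0 < d\<close> \<open>d < pi\<close> and \<alpha> = \<open>0 < \<alpha>\<close> \<open>\<alpha> \<le> 1\<close>
  define P where "P = (\<lambda>x. (1 + exp (- \<alpha> * x)) * (1 + exp (\<alpha> * x)))"
  have P_pos: "0 < P x" for x
    unfolding P_def by (intro mult_pos_pos add_pos_pos) auto
  obtain CK where CK: "\<And>i j. 0 \<le> CK i j" "\<And>i j \<zeta>. \<zeta> \<in> strip d \<Longrightarrow>
      norm (K (psi_SE a b \<zeta>) $ i $ j * Q_fun a b (psi_SE a b \<zeta>)) \<le> CK i j / P (Re \<zeta>)"
    using L_space_pullback(2)[OF ab d assms(6) \<alpha>(1)] unfolding P_def by metis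
  obtain Cg where Cg: "\<And>i. 0 \<le> Cg i" "\<And>i \<zeta>. \<zeta> \<in> strip d \<Longrightarrow>
      norm (g (psi_SE a b \<zeta>) $ i * Q_fun a b (psi_SE a b \<zeta>)) \<le> Cg i / P (Re \<zeta>)"
    using L_space_pullback(2)[OF ab d assms(7) \<alpha>(1)] unfolding P_def by metis
  \<comment> \<open>The sum of all the nonnegative constants is a single bound for every entry of
    \<open>K\<close> and \<open>g\<close>.\<close>
  define s where "s = (\<Sum>i\<in>UNIV. \<Sum>j\<in>UNIV. CK i j) + (\<Sum>i\<in>UNIV. Cg i)"
  have CK_le: "CK i j \<le> s" for i j
  proof -
    have "CK i j \<le> (\<Sum>j\<in>UNIV. CK i j)" "(\<Sum>j\<in>UNIV. CK i j) \<le> (\<Sum>i\<in>UNIV. \<Sum>j\<in>UNIV. CK i j)"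
      by (rule member_le_sum; simp add: CK sum_nonneg)+
    then show ?thesis using Cg(1) by (simp add: s_def sum_nonneg add_increasing2)
  qed
  have Cg_le: "Cg i \<le> s" for i
  proof -
    have "Cg i \<le> (\<Sum>i\<in>UNIV. Cg i)"
      by (rule member_le_sum) (auto simp: Cg)
    then show ?thesis using CK(1) by (simp add: s_def sum_nonneg add_increasing)
  qed
  have "0 \<le> s" using Cg(1) Cg_le order.trans by blast
  \<comment> \<open>Chosen so that \<open>\<sigma>' x\<close>, that is
    \<open>c * \<alpha> / P x\<close>, equals \<open>s / P x\<close> divided by
    \<open>b - a\<close>, the bound for the transformed coefficients.\<close>
  define c where "c = s / (\<alpha> * (b - a))"
  have "0 \<le> c" and c_eq: "c * \<alpha> = s / (b - a)"
    using \<open>0 \<le> s\<close> ab \<alpha> by (auto simp: c_def)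
  define \<sigma> where "\<sigma> = (\<lambda>x. c / (1 + exp (- \<alpha> * x)))"
  define \<sigma>' where "\<sigma>' = (\<lambda>x. c * \<alpha> / P x)"
  interpret majorant \<sigma> \<sigma>' c
    unfolding \<sigma>_def \<sigma>'_def P_def by (rule logistic_majorant[OF \<alpha>(1) \<open>0 \<le> c\<close>])
  \<comment> \<open>\<open>Q_fun\<close> divided by \<open>b - a\<close> is the derivative of the
    substitution, so \<open>A\<close> and \<open>h\<close> are the coefficients of the system on the
    strip.\<close>
  define A where "A = (\<lambda>i j \<zeta>. K (psi_SE a b \<zeta>) $ i $ j * Q_fun a b (psi_SE a b \<zeta>) / of_real (b - a))"
  define h where "h = (\<lambda>i \<zeta>. g (psi_SE a b \<zeta>) $ i * Q_fun a b (psi_SE a b \<zeta>) / of_real (b - a))"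
  have ba_nz: "of_real (b - a) \<noteq> (0 :: complex)"
    using ab by (simp del: of_real_diff)
  have A_hol: "A i j holomorphic_on strip d" and h_hol: "h i holomorphic_on strip d" for i j
    unfolding A_def h_def using ba_nz
    by (intro holomorphic_intros L_space_pullback(1)[OF ab d _ \<alpha>(1)] assms(6,7); simp)+
  have norm_le: "norm (w / of_real (b - a)) \<le> \<sigma>' x" if "norm w \<le> C / P x" "C \<le> s" for w :: complex and C x
  proof -
    have "norm w / (b - a) \<le> s / P x / (b - a)"
      using that P_pos[of x] ab by (intro divide_right_mono order.trans[OF that(1)]) auto
    moreover have "\<sigma>' x = s / P x / (b - a)"
      by (simp add: \<sigma>'_def c_eq)
    ultimately show ?thesis
      using ab by (simp add: norm_divide del: of_real_diff)
  qed
  have A_le: "norm (A i j \<zeta>) \<le> \<sigma>' (Re \<zeta>)" and h_le: "norm (h i \<zeta>) \<le> \<sigma>' (Re \<zeta>)"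
    if "\<zeta> \<in> strip d" for i j \<zeta>
    unfolding A_def h_def using norm_le[OF CK(2)[OF that] CK_le] norm_le[OF Cg(2)[OF that] Cg_le] by auto
  have "\<exists>u C. 0 \<le> C \<and> (\<forall>i. \<forall>\<zeta>\<in>strip d.
      (u i has_field_derivative (\<Sum>j\<in>UNIV. A i j \<zeta> * u j \<zeta>) + h i \<zeta>) (at \<zeta>) \<and>
      norm (u i \<zeta> - r $ i) \<le> C * \<sigma> (Re \<zeta>))"
    by (rule strip_system_solution[OF d(1) A_hol h_hol A_le h_le])
  then obtain u C where "0 \<le> C" and
    u_deriv0: "\<And>i \<zeta>. \<zeta> \<in> strip d \<Longrightarrow>
       (u i has_field_derivative (\<Sum>j\<in>UNIV. A i j \<zeta> * u j \<zeta>) + h i \<zeta>) (at \<zeta>)"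
    and u_a: "\<And>i \<zeta>. \<zeta> \<in> strip d \<Longrightarrow> norm (u i \<zeta> - r $ i) \<le> C * \<sigma> (Re \<zeta>)"
    by blast
  define u' where "u' = (\<lambda>i \<zeta>. (\<Sum>j\<in>UNIV. A i j \<zeta> * u j \<zeta>) + h i \<zeta>)"
  have u_deriv: "(u i has_field_derivative u' i \<zeta>) (at \<zeta>)" if "\<zeta> \<in> strip d" for i \<zeta>
    using u_deriv0[OF that] by (simp add: u'_def)
  define R where "R = norm r + C * c"
  have u_le: "norm (u i \<zeta>) \<le> R" if "\<zeta> \<in> strip d" for i \<zeta>
  proof -
    have "norm (u i \<zeta>) \<le> norm (r $ i) + norm (u i \<zeta> - r $ i)"
      using norm_triangle_sub by blast
    also have "\<dots> \<le> norm r + C * c"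
      using u_a[OF that, of i] mult_left_mono[OF \<sigma>_le \<open>0 \<le> C\<close>, of "Re \<zeta>"]
        Finite_Cartesian_Product.norm_nth_le[of r i] by linarith
    finally show ?thesis by (simp add: R_def)
  qed
  \<comment> \<open>In units of \<open>\<sigma>'\<close>, each of the \<open>CARD('n)\<close>
    products in \<open>u'\<close> contributes \<open>R\<close>, and \<open>h\<close> contributes
    \<open>1\<close>.\<close>
  define C1 where "C1 = CARD('n) * R + 1"
  have u'_le: "norm (u' i \<zeta>) \<le> C1 * \<sigma>' (Re \<zeta>)" if "\<zeta> \<in> strip d" for i \<zeta>
  proof -
    have "norm (\<Sum>j\<in>UNIV. A i j \<zeta> * u j \<zeta>) \<le> (\<Sum>j\<in>(UNIV::'n set). \<sigma>' (Re \<zeta>) * R)"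
      by (rule sum_norm_le) (auto simp: norm_mult intro!: mult_mono A_le u_le \<sigma>'_nonneg that)
    then have "norm (u' i \<zeta>) \<le> (\<Sum>j\<in>(UNIV::'n set). \<sigma>' (Re \<zeta>) * R) + \<sigma>' (Re \<zeta>)"
      unfolding u'_def by (intro norm_triangle_mono h_le that)
    then show ?thesis by (simp add: C1_def algebra_simps)
  qed
  have "\<exists>U. \<forall>\<zeta>\<in>strip d. norm (U - u i \<zeta>) \<le> C1 * (c - \<sigma> (Re \<zeta>))" for i
    by (rule strip_limit_at_top[OF d(1) u_deriv u'_le])
  then obtain U where u_b: "\<And>i \<zeta>. \<zeta> \<in> strip d \<Longrightarrow> norm (U i - u i \<zeta>) \<le> C1 * (c - \<sigma> (Re \<zeta>))"
    by metis
  define f where "f = (\<lambda>i z. if z = of_real a then r $ i else if z = of_real b then U i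
      else u i (SE_inv a b z))"
  have f_M: "f i \<in> M_space a b \<alpha> (SE_domain a b d)" for i
    unfolding f_def
  proof (rule M_space_pushforward[OF ab d \<alpha>])
    show "u i holomorphic_on strip d"
      using u_deriv by (auto simp: holomorphic_on_open[OF open_strip])
    \<comment> \<open>The pushforward takes one constant for both ends: \<open>C\<close> controls
      the left end of the strip and \<open>C1\<close> the right end.\<close>
    show "0 \<le> max C C1 * c" using \<open>0 \<le> c\<close> \<open>0 \<le> C\<close> by (simp add: max_def)
    fix \<zeta> assume \<zeta>: "\<zeta> \<in> strip d"
    have "C * \<sigma> (Re \<zeta>) \<le> max C C1 * \<sigma> (Re \<zeta>)"
      by (intro mult_right_mono \<sigma>_nonneg) auto
    with u_a[OF \<zeta>, of i] show "norm (u i \<zeta> - r $ i) \<le> max C C1 * c / (1 + exp (- \<alpha> * Re \<zeta>))"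
      by (simp add: \<sigma>_def)
    have "C1 * (c - \<sigma> (Re \<zeta>)) \<le> max C C1 * (c - \<sigma> (Re \<zeta>))"
      using \<sigma>_le[of "Re \<zeta>"] by (intro mult_right_mono) auto
    \<comment> \<open>Symmetry of the logistic function: its values at \<open>x\<close> and
      \<open>- x\<close> add up to the total mass.\<close>
    moreover have "c - \<sigma> (Re \<zeta>) = c / (1 + exp (\<alpha> * Re \<zeta>))"
    proof -
      have "1 + exp (\<alpha> * Re \<zeta>) \<noteq> 0" "1 + exp (- (\<alpha> * Re \<zeta>)) \<noteq> 0"
        using exp_gt_zero[of "\<alpha> * Re \<zeta>"] exp_gt_zero[of "- (\<alpha> * Re \<zeta>)"] by linarith+
      then show ?thesis by (simp add: \<sigma>_def exp_minus field_simps)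
    qed
    ultimately show "norm (U i - u i \<zeta>) \<le> max C C1 * c / (1 + exp (\<alpha> * Re \<zeta>))"
      using u_b[OF \<zeta>, of i] by simp
  qed
  define y where "y = (\<lambda>t. \<chi> i. f i (of_real t))"
  define \<xi> where "\<xi> = SE_inv_real a b"
  define \<xi>' where "\<xi>' = (\<lambda>t. (b - a) / ((t - a) * (b - t)))"
  define F where "F = (\<lambda>t. g (of_real t) + K (of_real t) *v y t)"
  have y_interior: "y t $ i = u i (of_real (\<xi> t))" if "t \<in> {a<..<b}" for t i
    using that by (simp add: y_def f_def \<xi>_def flip: SE_inv_of_real)
  \<comment> \<open>The derivative \<open>\<xi>'\<close> of the inverse substitution cancels
    \<open>Q_fun\<close> divided by \<open>b - a\<close> in \<open>A\<close> and \<open>h\<close>,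
    which restores \<open>K\<close> and \<open>g\<close>.\<close>
  have F_eq: "F t $ i = of_real (\<xi>' t) * u' i (of_real (\<xi> t))" if t: "t \<in> {a<..<b}" for t i
  proof -
    have psi: "psi_SE a b (of_real (\<xi> t)) = of_real t"
      unfolding \<xi>_def psi_SE_of_real psi_SE_real_SE_inv_real[OF ab t] ..
    have "of_real (\<xi>' t) * (Q_fun a b (of_real t) / of_real (b - a)) = of_real (\<xi>' t * ((t - a) * (b - t) / (b - a)))"
      by (simp add: Q_fun_def)
    also have "\<xi>' t * ((t - a) * (b - t) / (b - a)) = 1"
      using t by (simp add: \<xi>'_def)
    finally have Q: "of_real (\<xi>' t) * (w * Q_fun a b (of_real t) / of_real (b - a)) = w" for w
      by (metis mult.left_commute mult.right_neutral of_real_1 times_divide_eq_right)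
    have "of_real (\<xi>' t) * u' i (of_real (\<xi> t)) =
        (\<Sum>j\<in>UNIV. (of_real (\<xi>' t) * A i j (of_real (\<xi> t))) * u j (of_real (\<xi> t)))
        + of_real (\<xi>' t) * h i (of_real (\<xi> t))"
      by (simp add: u'_def distrib_left sum_distrib_left mult.assoc)
    also have "\<dots> = F t $ i"
      unfolding A_def h_def psi Q F_def
      by (simp add: matrix_vector_mult_def y_interior[OF t])
    finally show ?thesis by simp
  qed
  have y_deriv: "(y has_vector_derivative F t) (at t)" if t: "t \<in> {a<..<b}" for t
  proof (rule has_vector_derivative_vec)
    fix i
    have "((\<lambda>t. of_real (\<xi> t) :: complex) has_vector_derivative of_real (\<xi>' t)) (at t)"
      using SE_inv_real_deriv[OF t]
      by (intro bounded_linear.has_vector_derivative[OF bounded_linear_of_real])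
        (simp add: \<xi>_def \<xi>'_def has_real_derivative_iff_has_vector_derivative)
    from field_vector_diff_chain_at[OF this u_deriv[OF real_in_strip[OF d(1)], of i]]
    have "((\<lambda>t. u i (of_real (\<xi> t))) has_vector_derivative F t $ i) (at t)"
      by (simp add: o_def F_eq[OF t])
    then show "((\<lambda>t. y t $ i) has_vector_derivative F t $ i) (at t)"
      by (rule has_vector_derivative_transform_within_open[where S = "{a<..<b}"])
        (use t y_interior in auto)
  qed
  have y_cont: "continuous_on {a..b} y"
    unfolding y_def by (intro continuous_on_vec_lambda M_space_continuous_on[OF ab d f_M])
  have "y a = r" by (simp add: y_def f_def vec_eq_iff)
  \<comment> \<open>\<open>CARD('n)\<close> comes from bounding the norm by the sum over components;
    \<open>\<sigma>' (\<xi> t) * \<xi>' t\<close> is the integrand of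
    \<open>logistic_derivative_integrable\<close>.\<close>
  define B where "B = (\<lambda>t. CARD('n) * C1 * (\<sigma>' (\<xi> t) * \<xi>' t))"
  have F_le: "norm (F t) \<le> B t" if t: "t \<in> {a<..<b}" for t
  proof -
    have "norm (F t $ i) \<le> \<xi>' t * (C1 * \<sigma>' (\<xi> t))" for i
    proof -
      have "0 \<le> \<xi>' t" using t by (simp add: \<xi>'_def)
      then show ?thesis
        using mult_left_mono[OF u'_le[OF real_in_strip[OF d(1), of "\<xi> t"], of i]]
        by (simp add: F_eq[OF t] norm_mult)
    qed
    then have "(\<Sum>i\<in>UNIV. norm (F t $ i)) \<le> (\<Sum>i\<in>(UNIV::'n set). \<xi>' t * (C1 * \<sigma>' (\<xi> t)))"
      by (intro sum_mono)
    with norm_le_sum_components[of "F t"] show ?thesis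
      by (simp add: B_def mult_ac)
  qed
  have "B integrable_on {a..b}"
    using integrable_cmul[OF logistic_derivative_integrable[OF ab \<alpha>(1), of c], of "CARD('n) * C1"]
    by (simp add: B_def \<sigma>'_def \<xi>'_def \<xi>_def P_def)
  note sol = solves_integral_equation[OF y_cont y_deriv F_le this]
  have y_sol: "solves_ivp a b K g r y"
    using sol y_cont unfolding solves_ivp_def F_def \<open>y a = r\<close> by auto
  have K_cont: "isCont (\<lambda>s. K (of_real s) $ i $ j) t" if t: "t \<in> {a<..<b}" for i j t
  proof -
    let ?D = "SE_domain a b d"
    \<comment> \<open>Continuity of \<open>K\<close> is recovered by dividing by
      \<open>Q_fun\<close>, whose zeros \<open>a\<close> and \<open>b\<close> lie outside the
      domain.\<close>
    have "continuous_on ?D (\<lambda>z. K z $ i $ j * Q_fun a b z)"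
      using assms(6)[of i j]
      by (auto simp: L_space_def H_inf_def intro: holomorphic_on_imp_continuous_on analytic_imp_holomorphic)
    moreover have Q_nz: "Q_fun a b z \<noteq> 0" if "z \<in> ?D" for z
      using endpoints_notin_SE_domain[OF ab d] that by (auto simp: Q_fun_def)
    moreover have "continuous_on ?D (Q_fun a b)"
      unfolding Q_fun_def[abs_def] by (intro continuous_intros)
    ultimately have "continuous_on ?D (\<lambda>z. K z $ i $ j * Q_fun a b z / Q_fun a b z)"
      by (intro continuous_on_divide) auto
    then have "continuous_on ?D (\<lambda>z. K z $ i $ j)"
      by (rule continuous_on_eq) (simp add: Q_nz)
    then have K: "isCont (\<lambda>z. K z $ i $ j) (of_real t)"
      using of_real_in_SE_domain[OF ab d t] open_SE_domain[OF ab d]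
      by (simp add: continuous_on_eq_continuous_at)
    have "isCont (of_real :: real \<Rightarrow> complex) t"
      by (intro continuous_intros)
    from isCont_o2[OF this K] show ?thesis .
  qed
  have K_le: "norm (K (of_real (psi_SE_real a b x)) $ i $ j) *
        ((psi_SE_real a b x - a) * (b - psi_SE_real a b x) / (b - a)) \<le> \<sigma>' x" for i j x
  proof -
    define q where "q = psi_SE_real a b x"
    \<comment> \<open>The claim is \<open>A_le\<close> at a real point, where \<open>Q_fun\<close>
      is positive and equals its norm.\<close>
    have "norm (A i j (of_real x)) = norm (K (of_real q) $ i $ j) * norm (of_real ((q - a) * (b - q) / (b - a)) :: complex)"
      by (simp add: A_def psi_SE_of_real Q_fun_def q_def norm_mult norm_divide)
    also have "norm (of_real ((q - a) * (b - q) / (b - a)) :: complex) = (q - a) * (b - q) / (b - a)"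
      using psi_SE_real_bounds[OF ab, of x] ab unfolding norm_of_real by (simp add: q_def)
    finally show ?thesis
      using A_le[OF real_in_strip[OF d(1)], of i j x] by (simp add: q_def)
  qed
  show ?thesis
  proof (intro exI[of _ y] conjI allI impI ballI y_sol)
    show "w t = y t" if "solves_ivp a b K g r w" "t \<in> {a..b}" for w t
      by (rule ivp_unique[OF ab majorant_axioms K_cont K_le that(1) y_sol that(2)])
    show "extends_to_M_space a b \<alpha> (SE_domain a b d) (\<lambda>t. y t $ i)" for i
      unfolding extends_to_M_space_def by (intro bexI[of _ "f i"] f_M) (simp add: y_def)
  qed
qed

end
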